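(* Let $T_j\in\mathcal{O}p\,BS^1_{1,0}$, $j=1,\dots,n$, be defined by $T_j(f,g)=(D_jf)\,g$. Suppose that $[T_j,a]_1$ is bounded from $L^4\times L^4$ into $L^2$ for $j=1,\dots,n$. Then $a$ is a Lipschitz function. In particular, if $[T,a]_1$ is bounded from $L^4\times L^4$ into $L^2$ for all $T\in\mathcal{O}p\,BS^1_{1,0}$, then $a$ must be a Lipschitz function. The boundedness $[T,a]_1:L^4\times L^4\to L^2$ can be exchanged with a more general one $L^p\times L^q\to L^r$ for some Hölder triple $(p,q,r)\in[1,\infty)^3$. An analogous statement applies to the second commutator $[T,a]_2$.
   Context: Functions are on $\mathbb{R}^n$, $L^p=L^p(\mathbb{R}^n)$, and $D_j=-i\partial_{x_j}$. For a bilinear operator $T$ and a function $a$, the bilinear commutators are $[T,a]_1(f,g)=T(af,g)-aT(f,g)$ and $[T,a]_2(f,g)=T(f,ag)-aT(f,g)$. A Hölder triple $(p,q,r)$ is one with $1/p+1/q=1/r$. $\mathcal{O}p\,BS^1_{1,0}$ is the class of bilinear pseudodifferential operators $T_\sigma(f,g)(x)=\int_{\mathbb{R}^n}\int_{\mathbb{R}^n}\sigma(x,\xi,\eta)\widehat f(\xi)\widehat g(\eta)e^{ix\cdot(\xi+\eta)}\,d\xi\,d\eta$, a priori defined from $\mathcal{S}\times\mathcal{S}$ into $\mathcal{S}'$, whose symbol satisfies $|\partial_x^\alpha\partial_\xi^\beta\partial_\eta^\gamma\sigma(x,\xi,\eta)|\le C_{\alpha,\beta,\gamma}(1+|\xi|+|\eta|)^{1-|\beta|-|\gamma|}$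 for all $(x,\xi,\eta)\in\mathbb{R}^{3n}$ and all multi-indices $\alpha,\beta,\gamma$. *)

theory Defs
  imports "HOL-Analysis.Analysis"
begin

section \<open>Iterated partial derivatives, smoothness, Schwartz functions\<close>

definition partial :: "'a::euclidean_space \<Rightarrow> ('a \<Rightarrow> complex) \<Rightarrow> 'a \<Rightarrow> complex" where
  "partial b f = (\<lambda>x. frechet_derivative f (at x) b)"

text \<open>
  A list of coordinate directions plays the role of a multi-index; the order of differentiation is
  the length of the list. For smooth functions partial derivatives commute, so ranging over all
  lists is the same as ranging over all multi-indices.
\<close>
definition partials :: "'a::euclidean_space list \<Rightarrow> ('a \<Rightarrow> complex) \<Rightarrow> 'a \<Rightarrow> complex" where
  "partials bs f = foldr partial bs f"

definition smooth :: "('a::euclidean_space \<Rightarrow> complex) \<Rightarrow> bool" where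
  "smooth f \<longleftrightarrow> (\<forall>bs. set bs \<subseteq> Basis \<longrightarrow> (\<forall>x. partials bs f differentiable (at x)))"

definition schwartz :: "('a::euclidean_space \<Rightarrow> complex) \<Rightarrow> bool" where
  "schwartz f \<longleftrightarrow> smooth f \<and>
     (\<forall>k::nat. \<forall>bs. set bs \<subseteq> Basis \<longrightarrow>
        (\<exists>C. \<forall>x. (1 + norm x) ^ k * norm (partials bs f x) \<le> C))"

definition Dj :: "'n::finite \<Rightarrow> (real^'n \<Rightarrow> complex) \<Rightarrow> real^'n \<Rightarrow> complex" where
  "Dj j f x = - \<i> * partial (axis j 1) f x"

section \<open>Bilinear pseudodifferential operators\<close>

text \<open>
  The normalisation is the one for which the symbol 1 gives the pointwise product, since there is no
  factor of \<open>2 * pi\<close> in the defining formula of the bilinear operator.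
\<close>
definition fourier :: "(real^'n::finite \<Rightarrow> complex) \<Rightarrow> real^'n \<Rightarrow> complex" where
  "fourier f \<xi> = of_real (1 / (2 * pi) ^ CARD('n)) *
     (LINT x|lebesgue. f x * cis (- (x \<bullet> \<xi>)))"

definition BS1_symbol :: "((real^'n::finite) \<times> (real^'n) \<times> (real^'n) \<Rightarrow> complex) \<Rightarrow> bool" where
  "BS1_symbol \<sigma> \<longleftrightarrow> smooth \<sigma> \<and>
     (\<forall>\<alpha> \<beta> \<gamma> :: 'n list. \<exists>C. \<forall>x \<xi> \<eta>.
        norm (partials (map (\<lambda>j. (axis j 1, 0, 0)) \<alpha> @ map (\<lambda>j. (0, axis j 1, 0)) \<beta> @
                        map (\<lambda>j. (0, 0, axis j 1)) \<gamma>) \<sigma> (x, \<xi>, \<eta>))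
          \<le> C * (1 + norm \<xi> + norm \<eta>) powr (1 - real (length \<beta>) - real (length \<gamma>)))"

type_synonym 'n bilin_op =
  "(real^'n \<Rightarrow> complex) \<Rightarrow> (real^'n \<Rightarrow> complex) \<Rightarrow> real^'n \<Rightarrow> complex"

definition bilin_psdo :: "((real^'n::finite) \<times> (real^'n) \<times> (real^'n) \<Rightarrow> complex) \<Rightarrow> 'n bilin_op" where
  "bilin_psdo \<sigma> f g x =
     (LINT \<xi>|lebesgue. LINT \<eta>|lebesgue.
        \<sigma> (x, \<xi>, \<eta>) * fourier f \<xi> * fourier g \<eta> * cis (x \<bullet> (\<xi> + \<eta>)))"

text \<open>
  Only the values on pairs of Schwartz functions matter; the values of a member of this set on other
  arguments are arbitrary and are never used below.
\<close>
definition OpBS1 :: "('n::finite) bilin_op set" where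
  "OpBS1 = {T. \<exists>\<sigma>. BS1_symbol \<sigma> \<and>
     (\<forall>f g. schwartz f \<longrightarrow> schwartz g \<longrightarrow> T f g = bilin_psdo \<sigma> f g)}"

section \<open>Commutators\<close>

text \<open>
  Elements of the space of tempered distributions are represented by their action on Schwartz
  functions, through the bilinear pairing \<open>\<integral> F \<phi>\<close> when \<open>F\<close> is a function.
\<close>
type_synonym 'n distr = "(real^'n \<Rightarrow> complex) \<Rightarrow> complex"

text \<open>
  For \<open>T\<close> in \<^const>\<open>OpBS1\<close> and a Schwartz function \<open>g\<close>, the operator \<open>T(\<cdot>, g)\<close> is a linear
  pseudodifferential operator; its transpose maps Schwartz functions to Schwartz functions, and
  \<open>T(u, g)\<close> is defined by duality for tempered \<open>u\<close>. The same holds in the second argument.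
  This is what gives a meaning to \<open>T(a f, g)\<close> and \<open>T(f, a g)\<close> when \<open>a\<close> is not smooth. The transposed
  function is unique since the Schwartz functions separate points.
\<close>
definition transpose1 ::
  "('n::finite) bilin_op \<Rightarrow> (real^'n \<Rightarrow> complex) \<Rightarrow> (real^'n \<Rightarrow> complex) \<Rightarrow> real^'n \<Rightarrow> complex" where
  "transpose1 T g \<phi> = (THE h. schwartz h \<and> (\<forall>f. schwartz f \<longrightarrow>
     (LINT x|lebesgue. T f g x * \<phi> x) = (LINT x|lebesgue. f x * h x)))"

definition transpose2 ::
  "('n::finite) bilin_op \<Rightarrow> (real^'n \<Rightarrow> complex) \<Rightarrow> (real^'n \<Rightarrow> complex) \<Rightarrow> real^'n \<Rightarrow> complex" where
  "transpose2 T f \<phi> = (THE h. schwartz h \<and> (\<forall>g. schwartz g \<longrightarrow>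
     (LINT x|lebesgue. T f g x * \<phi> x) = (LINT x|lebesgue. g x * h x)))"

definition extend1 ::
  "('n::finite) bilin_op \<Rightarrow> (real^'n \<Rightarrow> complex) \<Rightarrow> (real^'n \<Rightarrow> complex) \<Rightarrow> 'n distr" where
  "extend1 T u g \<phi> = (LINT x|lebesgue. u x * transpose1 T g \<phi> x)"

definition extend2 ::
  "('n::finite) bilin_op \<Rightarrow> (real^'n \<Rightarrow> complex) \<Rightarrow> (real^'n \<Rightarrow> complex) \<Rightarrow> 'n distr" where
  "extend2 T f u \<phi> = (LINT x|lebesgue. u x * transpose2 T f \<phi> x)"

text \<open>
  The functions \<open>a\<close> (measurable, locally integrable and of polynomial growth in the mean) for which
  both terms of the commutators are tempered distributions.
\<close>
definition tempered_fun :: "(real^'n::finite \<Rightarrow> complex) \<Rightarrow> bool" where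
  "tempered_fun a \<longleftrightarrow> (\<forall>\<phi>. schwartz \<phi> \<longrightarrow> integrable lebesgue (\<lambda>x. a x * \<phi> x))"

definition commutator1 ::
  "('n::finite) bilin_op \<Rightarrow> (real^'n \<Rightarrow> complex) \<Rightarrow>
   (real^'n \<Rightarrow> complex) \<Rightarrow> (real^'n \<Rightarrow> complex) \<Rightarrow> 'n distr" where
  "commutator1 T a f g \<phi> =
     extend1 T (\<lambda>x. a x * f x) g \<phi> - (LINT x|lebesgue. a x * T f g x * \<phi> x)"

definition commutator2 ::
  "('n::finite) bilin_op \<Rightarrow> (real^'n \<Rightarrow> complex) \<Rightarrow>
   (real^'n \<Rightarrow> complex) \<Rightarrow> (real^'n \<Rightarrow> complex) \<Rightarrow> 'n distr" where
  "commutator2 T a f g \<phi> =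
     extend2 T f (\<lambda>x. a x * g x) \<phi> - (LINT x|lebesgue. a x * T f g x * \<phi> x)"

section \<open>Boundedness on Lebesgue spaces\<close>

definition in_Lp :: "real \<Rightarrow> (real^'n::finite \<Rightarrow> complex) \<Rightarrow> bool" where
  "in_Lp p f \<longleftrightarrow> f \<in> borel_measurable lebesgue \<and>
     integrable lebesgue (\<lambda>x. norm (f x) powr p)"

definition Lp_norm :: "real \<Rightarrow> (real^'n::finite \<Rightarrow> complex) \<Rightarrow> real" where
  "Lp_norm p f = (LINT x|lebesgue. norm (f x) powr p) powr (1 / p)"

text \<open>
  Boundedness of an operator that is a priori defined from pairs of Schwartz functions (dense in
  the Lebesgue spaces with finite exponents) into tempered distributions.
\<close>
definition bounded_Lp ::
  "real \<Rightarrow> real \<Rightarrow> real \<Rightarrow>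
   ((real^'n::finite \<Rightarrow> complex) \<Rightarrow> (real^'n \<Rightarrow> complex) \<Rightarrow> 'n distr) \<Rightarrow> bool" where
  "bounded_Lp p q r B \<longleftrightarrow> (\<exists>C. \<forall>f g. schwartz f \<longrightarrow> schwartz g \<longrightarrow>
     (\<exists>F. in_Lp r F \<and>
        (\<forall>\<phi>. schwartz \<phi> \<longrightarrow> B f g \<phi> = (LINT x|lebesgue. F x * \<phi> x)) \<and>
        Lp_norm r F \<le> C * Lp_norm p f * Lp_norm q g))"

definition hoelder_triple :: "real \<Rightarrow> real \<Rightarrow> real \<Rightarrow> bool" where
  "hoelder_triple p q r \<longleftrightarrow> 1 \<le> p \<and> 1 \<le> q \<and> 1 \<le> r \<and> 1 / p + 1 / q = 1 / r"

text \<open>Functions are identified when they agree almost everywhere.\<close>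
definition lipschitz_fun :: "(real^'n::finite \<Rightarrow> complex) \<Rightarrow> bool" where
  "lipschitz_fun a \<longleftrightarrow>
     (\<exists>b C. C-lipschitz_on UNIV b \<and> (AE x in lebesgue. a x = b x))"

section \<open>The model operators\<close>

definition T1 :: "'n::finite \<Rightarrow> 'n bilin_op" where
  "T1 j f g x = Dj j f x * g x"

text \<open>
  The operators for the second commutator have the derivative on the second argument: the second
  commutator of \<open>(D_j f) g\<close> with any function vanishes.
\<close>
definition T2 :: "'n::finite \<Rightarrow> 'n bilin_op" where
  "T2 j f g x = f x * Dj j g x"

end

theory Submission
  imports Defs "HOL-Probability.Probability"
begin

text \<open>
  Moving the derivative of \<open>T\<^sub>j(a f, g) = D\<^sub>j(a f) g\<close> onto the test function shows that the
  commutator \<open>[T\<^sub>j, a]\<^sub>1(f, g)\<close> is the distribution \<open>(D\<^sub>j a) f g\<close>; paired with \<open>\<phi>\<close> it is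
  \<open>- \<integral> a D\<^sub>j(f g \<phi>)\<close> (lemma \<open>commutator1_T1\<close>). The boundedness hypothesis is tested with
  \<open>f\<close>, \<open>g\<close> and \<open>\<phi>\<close> all equal to the Gaussian \<open>exp (- t \<bar>y - x\<bar>\<^sup>2)\<close>. Since \<open>1/p + 1/q = 1/r\<close>,
  the bound scales in \<open>t\<close> like the integral of a Gaussian (lemma \<open>bounded_Lp_gaussian\<close>), so the
  gradient of \<open>a\<close> averaged against a normalised Gaussian of any centre and width is bounded by one
  constant. Consequently the Gaussian averages of \<open>a\<close> are Lipschitz continuous with a common
  constant (lemma \<open>gaussian_average_lipschitz\<close>).

  As \<open>t\<close> tends to infinity the averages converge to \<open>a\<close> in a Gaussian-weighted space of integrable
  functions, because they do so for bounded continuous functions, which are dense, and because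
  averaging is bounded uniformly in \<open>t\<close> (lemma \<open>gaussian_average_tendsto_L1\<close>). A subsequence converges
  almost everywhere, and the Lipschitz bound survives on a dense set of full measure, from which it
  extends to a Lipschitz representative (lemma \<open>lipschitz_representative\<close>).

  That the model operators are bilinear pseudodifferential operators, with the symbols \<open>\<xi>\<^sub>j\<close> and
  \<open>\<eta>\<^sub>j\<close>, is the Fourier inversion formula for Schwartz functions (lemma \<open>fourier_inversion\<close>). Its
  proof rests on the same averages: a Gaussian factor in the frequency integral turns the inversion
  integral into a Gaussian average of the function.
\<close>

section \<open>Closure properties of the Schwartz class\<close>

lemma partial_eqI: "(f has_derivative f') (at x) \<Longrightarrow> partial b f x = f' b"
  unfolding partial_def using frechet_derivative_at by metis

lemma partials_append: "partials (bs @ cs) f = partials bs (partials cs f)"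
  by (simp add: partials_def)

text \<open>
  Membership in the Schwartz class is most easily shown by coinduction: it suffices to exhibit the
  function in some class that is stable under partial derivatives and whose members are
  differentiable and rapidly decreasing. Induction on the order of differentiation happens here only.
\<close>
lemma schwartz_coinduct:
  assumes "f \<in> S"
    and diff: "\<And>g x. g \<in> S \<Longrightarrow> g differentiable (at x)"
    and closed: "\<And>g b. g \<in> S \<Longrightarrow> b \<in> Basis \<Longrightarrow> partial b g \<in> S"
    and decay: "\<And>g k. g \<in> S \<Longrightarrow> \<exists>C. \<forall>x. (1 + norm x) ^ k * norm (g x) \<le> C"
  shows "schwartz f"
proof -
  have "partials bs f \<in> S" if "set bs \<subseteq> Basis" for bs
    using that by (induction bs) (auto simp: partials_def \<open>f \<in> S\<close> intro!: closed)
  then show ?thesis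
    unfolding schwartz_def smooth_def using diff decay by blast
qed

lemma schwartz_differentiable: "schwartz f \<Longrightarrow> f differentiable (at x)"
  unfolding schwartz_def smooth_def by (auto simp: partials_def dest!: spec[of _ "[]"])

lemma schwartz_decay: "schwartz f \<Longrightarrow> \<exists>C. \<forall>x. (1 + norm x) ^ k * norm (f x) \<le> C"
  unfolding schwartz_def
  by (elim conjE allE[of _ k] allE[of _ "[]"]) (simp add: partials_def)

lemma schwartz_partial:
  assumes "schwartz f" "b \<in> Basis"
  shows "schwartz (partial b f)"
proof -
  have eq: "partials bs (partial b f) = partials (bs @ [b]) f" for bs
    by (simp add: partials_def)
  have "set (bs @ [b]) \<subseteq> Basis" if "set bs \<subseteq> Basis" for bs
    using that assms by auto
  then show ?thesis
    using assms(1) unfolding schwartz_def smooth_def eq by blast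
qed

lemma schwartz_continuous: "schwartz f \<Longrightarrow> continuous_on UNIV f"
  by (meson differentiable_imp_continuous_within schwartz_differentiable continuous_at_imp_continuous_on)

lemma partial_add:
  assumes "f differentiable (at x)" "g differentiable (at x)"
  shows "partial b (\<lambda>x. f x + g x) x = partial b f x + partial b g x"
  using assms unfolding frechet_derivative_works
  by (subst partial_eqI[OF has_derivative_add]) (auto simp: partial_def)

lemma partial_mult:
  assumes "f differentiable (at x)" "g differentiable (at x)"
  shows "partial b (\<lambda>x. f x * g x) x = f x * partial b g x + partial b f x * g x"
  using assms unfolding frechet_derivative_works
  by (subst partial_eqI[OF has_derivative_mult]) (auto simp: partial_def)

lemma partial_bounded_linear:
  assumes "bounded_linear L" "f differentiable (at x)"
  shows "partial b (\<lambda>x. L (f x)) x = L (partial b f x)"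
  using assms unfolding frechet_derivative_works
  by (subst partial_eqI[OF bounded_linear.has_derivative]) (auto simp: partial_def)

lemma schwartz_add:
  assumes "schwartz f" "schwartz g"
  shows "schwartz (\<lambda>x. f x + g x)"
proof (rule schwartz_coinduct)
  let ?S = "{\<lambda>x. f x + g x | f g :: 'a \<Rightarrow> complex. schwartz f \<and> schwartz g}"
  show "(\<lambda>x. f x + g x) \<in> ?S" using assms by blast
  fix h assume "h \<in> ?S"
  then obtain f g where h: "h = (\<lambda>x. f x + g x)" and S: "schwartz f" "schwartz g" by auto
  note d = schwartz_differentiable[OF S(1)] schwartz_differentiable[OF S(2)]
  show "h differentiable (at x)" for x
    unfolding h using d by (rule differentiable_add)
  show "partial b h \<in> ?S" if "b \<in> Basis" for b
  proof -
    have "partial b h = (\<lambda>x. partial b f x + partial b g x)"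
      unfolding h by (intro ext partial_add d)
    then show ?thesis using S schwartz_partial that by blast
  qed
  show "\<exists>C. \<forall>x. (1 + norm x) ^ k * norm (h x) \<le> C" for k
  proof -
    obtain C D where CD: "\<And>x. (1 + norm x) ^ k * norm (f x) \<le> C" "\<And>x. (1 + norm x) ^ k * norm (g x) \<le> D"
      using S schwartz_decay by metis
    have "(1 + norm x) ^ k * norm (h x) \<le> C + D" for x
    proof -
      have "(1 + norm x) ^ k * norm (h x) \<le> (1 + norm x) ^ k * (norm (f x) + norm (g x))"
        unfolding h by (intro mult_left_mono norm_triangle_ineq) auto
      then show ?thesis using CD[of x] by (simp add: distrib_left)
    qed
    then show ?thesis by blast
  qed
qed

lemma schwartz_bounded_linear:
  assumes "bounded_linear L" "schwartz f"
  shows "schwartz (\<lambda>x. L (f x))"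
proof (rule schwartz_coinduct)
  let ?S = "{\<lambda>x. L (f x) | f :: 'a \<Rightarrow> complex. schwartz f}"
  show "(\<lambda>x. L (f x)) \<in> ?S" using assms by blast
  fix h assume "h \<in> ?S"
  then obtain f where h: "h = (\<lambda>x. L (f x))" and S: "schwartz f" by auto
  note d = schwartz_differentiable[OF S]
  show "h differentiable (at x)" for x
    unfolding h using d assms(1) bounded_linear.has_derivative frechet_derivative_works
    by (metis differentiable_def)
  show "partial b h \<in> ?S" if "b \<in> Basis" for b
  proof -
    have "partial b h = (\<lambda>x. L (partial b f x))"
      unfolding h by (intro ext partial_bounded_linear d assms)
    then show ?thesis using S schwartz_partial that by blast
  qed
  show "\<exists>C. \<forall>x. (1 + norm x) ^ k * norm (h x) \<le> C" for k
  proof -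
    obtain C where C: "\<And>x. (1 + norm x) ^ k * norm (f x) \<le> C"
      using S schwartz_decay by metis
    obtain K where K: "K > 0" "\<And>z. norm (L z) \<le> norm z * K"
      using bounded_linear.pos_bounded[OF assms(1)] by blast
    have "(1 + norm x) ^ k * norm (h x) \<le> C * K" for x
    proof -
      have "(1 + norm x) ^ k * norm (h x) \<le> (1 + norm x) ^ k * (norm (f x) * K)"
        unfolding h by (intro mult_left_mono K) auto
      also have "\<dots> \<le> C * K"
        using C[of x] K(1) by (simp add: mult.assoc[symmetric])
      finally show ?thesis .
    qed
    then show ?thesis by blast
  qed
qed

lemma schwartz_cmult: "schwartz f \<Longrightarrow> schwartz (\<lambda>x. c * f x)"
  by (rule schwartz_bounded_linear[OF bounded_linear_mult_right])

lemma schwartz_cnj: "schwartz f \<Longrightarrow> schwartz (\<lambda>x. cnj (f x))"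
  by (rule schwartz_bounded_linear[OF bounded_linear_cnj])

lemma schwartz_diff: "schwartz f \<Longrightarrow> schwartz g \<Longrightarrow> schwartz (\<lambda>x. f x - g x)"
  using schwartz_add[OF _ schwartz_cmult[of g "-1"]] by simp

text \<open>
  Products of Schwartz functions are not stable under differentiation, but their finite sums are;
  this is the class used for the coinduction.
\<close>
inductive_set sums_of_products :: "('a::euclidean_space \<Rightarrow> complex) set" where
  prod: "schwartz f \<Longrightarrow> schwartz g \<Longrightarrow> (\<lambda>x. f x * g x) \<in> sums_of_products"
| sum: "u \<in> sums_of_products \<Longrightarrow> v \<in> sums_of_products \<Longrightarrow> (\<lambda>x. u x + v x) \<in> sums_of_products"

lemma schwartz_mult:
  assumes "schwartz f" "schwartz g"
  shows "schwartz (\<lambda>x. f x * g x)"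
proof (rule schwartz_coinduct[where S = sums_of_products])
  show "(\<lambda>x. f x * g x) \<in> sums_of_products" using assms by (rule prod)
  show diff: "h differentiable (at x)" if "h \<in> sums_of_products" for h :: "'a \<Rightarrow> complex" and x
    using that by induction (auto intro: differentiable_mult schwartz_differentiable differentiable_add)
  show "partial b h \<in> sums_of_products" if "h \<in> sums_of_products" "b \<in> Basis" for h :: "'a \<Rightarrow> complex" and b
    using that
  proof induction
    case (prod f g)
    then have "partial b (\<lambda>x. f x * g x) = (\<lambda>x. f x * partial b g x + partial b f x * g x)"
      by (intro ext partial_mult schwartz_differentiable)
    then show ?case
      using prod by (auto intro!: sums_of_products.intros schwartz_partial)
  next
    case (sum u v)
    then have "partial b (\<lambda>x. u x + v x) = (\<lambda>x. partial b u x + partial b v x)"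
      by (intro ext partial_add diff)
    then show ?case
      using sum by (auto intro!: sums_of_products.intros)
  qed
  show "\<exists>C. \<forall>x. (1 + norm x) ^ k * norm (h x) \<le> C" if "h \<in> sums_of_products" for h :: "'a \<Rightarrow> complex" and k
    using that
  proof induction
    case (prod f g)
    obtain C D where C: "\<And>x. (1 + norm x) ^ k * norm (f x) \<le> C" and D: "\<And>x. norm (g x) \<le> D"
      using schwartz_decay[OF prod(1), of k] schwartz_decay[OF prod(2), of 0] by auto
    have "(1 + norm x) ^ k * norm (f x * g x) \<le> C * D" for x
    proof -
      have "0 \<le> (1 + norm x) ^ k * norm (f x)" by simp
      then have "0 \<le> C" using C[of x] by linarith
      then have "(1 + norm x) ^ k * norm (f x) * norm (g x) \<le> C * D"
        using C[of x] D[of x] by (intro mult_mono) auto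
      then show ?thesis by (simp add: norm_mult mult_ac)
    qed
    then show ?case by blast
  next
    case (sum u v)
    then obtain C D where CD: "\<And>x. (1 + norm x) ^ k * norm (u x) \<le> C" "\<And>x. (1 + norm x) ^ k * norm (v x) \<le> D"
      by blast
    have "(1 + norm x) ^ k * norm (u x + v x) \<le> C + D" for x
    proof -
      have "(1 + norm x) ^ k * norm (u x + v x) \<le> (1 + norm x) ^ k * (norm (u x) + norm (v x))"
        by (intro mult_left_mono norm_triangle_ineq) auto
      then show ?thesis using CD[of x] by (simp add: distrib_left)
    qed
    then show ?case by blast
  qed
qed

section \<open>Gaussians\<close>

definition gaussian :: "real \<Rightarrow> 'a::euclidean_space \<Rightarrow> 'a \<Rightarrow> real" where
  "gaussian t x y = exp (- t * (norm (y - x))\<^sup>2)"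

lemma gaussian_pos: "0 < gaussian t x y"
  by (simp add: gaussian_def)

lemma gaussian_le_1: "0 \<le> t \<Longrightarrow> gaussian t x y \<le> 1"
  by (simp add: gaussian_def)

lemma continuous_gaussian [continuous_intros]: "continuous_on S (gaussian t x)"
  unfolding gaussian_def by (intro continuous_intros)

lemma gaussian_has_derivative:
  "(gaussian t x has_derivative (\<lambda>v. - 2 * t * ((y - x) \<bullet> v) * gaussian t x y)) (at y)"
  unfolding gaussian_def power2_norm_eq_inner
  by (auto intro!: derivative_eq_intros simp: algebra_simps inner_commute)

lemma real_polynomial_function_bound:
  fixes p :: "'a::real_normed_vector \<Rightarrow> real"
  assumes "real_polynomial_function p"
  shows "\<exists>C m. \<forall>x. \<bar>p x\<bar> \<le> C * (1 + norm x) ^ m"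
  using assms
proof induction
  case (linear f)
  then obtain K where K: "K > 0" "\<And>z. norm (f z) \<le> norm z * K"
    using bounded_linear.pos_bounded by blast
  have "\<bar>f x\<bar> \<le> K * (1 + norm x) ^ 1" for x
    using K(2)[of x] K(1) by (simp add: algebra_simps)
  then show ?case by blast
next
  case (const c)
  have "\<bar>c\<bar> \<le> \<bar>c\<bar> * (1 + norm (x::'a)) ^ 0" for x by simp
  then show ?case by blast
next
  case (add f g)
  then obtain C m D k where CD: "\<And>x. \<bar>f x\<bar> \<le> C * (1 + norm x) ^ m" "\<And>x. \<bar>g x\<bar> \<le> D * (1 + norm x) ^ k"
    by blast
  have "C * (1 + norm (0::'a)) ^ m \<ge> 0" "D * (1 + norm (0::'a)) ^ k \<ge> 0"
    using CD[of 0] by linarith+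
  then have pos: "C \<ge> 0" "D \<ge> 0" by simp_all
  have "\<bar>f x + g x\<bar> \<le> (C + D) * (1 + norm x) ^ (m + k)" for x
  proof -
    have "C * (1 + norm x) ^ m \<le> C * (1 + norm x) ^ (m + k)" "D * (1 + norm x) ^ k \<le> D * (1 + norm x) ^ (m + k)"
      using pos by (auto intro!: mult_left_mono power_increasing)
    then show ?thesis using CD[of x] by (simp add: distrib_right)
  qed
  then show ?case by blast
next
  case (mult f g)
  then obtain C m D k where CD: "\<And>x. \<bar>f x\<bar> \<le> C * (1 + norm x) ^ m" "\<And>x. \<bar>g x\<bar> \<le> D * (1 + norm x) ^ k"
    by blast
  have "\<bar>f x * g x\<bar> \<le> (C * D) * (1 + norm x) ^ (m + k)" for x
  proof -
    have "0 \<le> C * (1 + norm x) ^ m" using CD(1)[of x] by linarith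
    then have "\<bar>f x\<bar> * \<bar>g x\<bar> \<le> (C * (1 + norm x) ^ m) * (D * (1 + norm x) ^ k)"
      using CD[of x] by (intro mult_mono) auto
    then show ?thesis by (simp add: abs_mult power_add mult_ac)
  qed
  then show ?case by blast
qed

lemma real_polynomial_function_derivative:
  fixes p :: "'a::real_normed_vector \<Rightarrow> real"
  assumes "real_polynomial_function p"
  shows "\<exists>q. real_polynomial_function (\<lambda>x. q x b) \<and> (\<forall>x. (p has_derivative q x) (at x))"
  using assms
proof induction
  case (linear f)
  then show ?case
    by (intro exI[of _ "\<lambda>x. f"]) (auto intro: bounded_linear_imp_has_derivative)
next
  case (const c)
  then show ?case by (intro exI[of _ "\<lambda>x y. 0"]) auto
next
  case (add f g)
  then obtain q r where "real_polynomial_function (\<lambda>x. q x b)" "\<And>x. (f has_derivative q x) (at x)"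
    "real_polynomial_function (\<lambda>x. r x b)" "\<And>x. (g has_derivative r x) (at x)" by blast
  then show ?case
    by (intro exI[of _ "\<lambda>x y. q x y + r x y"]) (auto intro!: has_derivative_add)
next
  case (mult f g)
  then obtain q r where "real_polynomial_function (\<lambda>x. q x b)" "\<And>x. (f has_derivative q x) (at x)"
    "real_polynomial_function (\<lambda>x. r x b)" "\<And>x. (g has_derivative r x) (at x)" by blast
  then show ?case using mult
    by (intro exI[of _ "\<lambda>x y. f x * r x y + q x y * g x"]) (auto intro!: has_derivative_mult)
qed

lemma power_times_gaussian_bounded:
  assumes "t > 0"
  shows "\<exists>C. \<forall>y. (1 + norm y) ^ k * gaussian t x y \<le> C"
proof -
  have lim: "((\<lambda>s. (1 + N + s) ^ k * exp (- t * s\<^sup>2)) \<longlongrightarrow> 0) at_top" for N :: real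
    using assms by real_asymp
  define N where "N = norm x"
  have "\<forall>\<^sub>F s in at_top. (1 + N + s) ^ k * exp (- t * s\<^sup>2) < 1"
    using lim[of N] by (rule order_tendstoD) simp
  then obtain R where R: "\<And>s. s \<ge> R \<Longrightarrow> (1 + N + s) ^ k * exp (- t * s\<^sup>2) < 1"
    by (auto simp: eventually_at_top_linorder)
  have "(1 + norm y) ^ k * gaussian t x y \<le> 1 + (1 + N + \<bar>R\<bar>) ^ k" for y
  proof -
    define s where "s = norm (y - x)"
    have s: "s \<ge> 0" "norm y \<le> N + s"
      using norm_triangle_sub[of y x] by (auto simp: s_def N_def)
    have N: "N \<ge> 0" by (simp add: N_def)
    have "(1 + norm y) ^ k * gaussian t x y \<le> (1 + N + s) ^ k * exp (- t * s\<^sup>2)"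
      using s by (auto simp: gaussian_def s_def intro!: mult_right_mono power_mono)
    also have "\<dots> \<le> 1 + (1 + N + \<bar>R\<bar>) ^ k"
    proof (cases "s \<ge> R")
      case True
      have "0 \<le> (1 + N + \<bar>R\<bar>) ^ k" using N by simp
      then show ?thesis using R[OF True] by linarith
    next
      case False
      have "(1 + N + s) ^ k * exp (- t * s\<^sup>2) \<le> (1 + N + \<bar>R\<bar>) ^ k * 1"
        using False s N assms by (intro mult_mono power_mono) auto
      then show ?thesis by simp
    qed
    finally show ?thesis .
  qed
  then show ?thesis by blast
qed

lemma schwartz_gaussian:
  assumes "t > 0"
  shows "schwartz (\<lambda>y. complex_of_real (gaussian t x y))"
proof (rule schwartz_coinduct)
  let ?S = "{\<lambda>y. complex_of_real (p y * gaussian t x y) | p. real_polynomial_function p}"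
  show "(\<lambda>y. complex_of_real (gaussian t x y)) \<in> ?S"
    by (rule CollectI, rule exI[of _ "\<lambda>_. 1"]) auto
  fix h assume "h \<in> ?S"
  then obtain p where h: "h = (\<lambda>y. complex_of_real (p y * gaussian t x y))" and p: "real_polynomial_function p"
    by auto
  have D: "\<exists>D. real_polynomial_function (\<lambda>y. D y b) \<and>
      (\<forall>y. (h has_derivative (\<lambda>v. complex_of_real (D y v * gaussian t x y))) (at y))" for b
  proof -
    obtain q where q: "real_polynomial_function (\<lambda>x. q x b)" "\<And>y. (p has_derivative q y) (at y)"
      using real_polynomial_function_derivative[OF p] by metis
    have lin: "real_polynomial_function (\<lambda>y. (y - x) \<bullet> b)"
      unfolding inner_diff_left
      by (intro real_polynomial_function_diff real_polynomial_function.intros(1,2) bounded_linear_inner_left)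
    show ?thesis
    proof (intro exI conjI allI)
      show "real_polynomial_function (\<lambda>y. q y b + p y * (- 2 * t * ((y - x) \<bullet> b)))"
        by (intro real_polynomial_function.intros(2-) q p lin)
      show "(h has_derivative (\<lambda>v. complex_of_real ((q y v + p y * (- 2 * t * ((y - x) \<bullet> v))) * gaussian t x y)))
          (at y)" for y
        unfolding h
        by (rule has_derivative_of_real, rule has_derivative_eq_rhs[OF has_derivative_mult[OF q(2) gaussian_has_derivative]])
          (auto simp: algebra_simps)
    qed
  qed
  then show "h differentiable (at x)" for x
    unfolding differentiable_def by blast
  show "partial b h \<in> ?S" for b
  proof -
    obtain D where "real_polynomial_function (\<lambda>y. D y b)"
      "\<And>y. (h has_derivative (\<lambda>v. complex_of_real (D y v * gaussian t x y))) (at y)"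
      using D[of b] by blast
    moreover from this have "partial b h = (\<lambda>y. complex_of_real (D y b * gaussian t x y))"
      by (intro ext partial_eqI)
    ultimately show ?thesis by (intro CollectI exI conjI)
  qed
  show "\<exists>C. \<forall>y. (1 + norm y) ^ k * norm (h y) \<le> C" for k
  proof -
    obtain C m where C: "\<And>x. \<bar>p x\<bar> \<le> C * (1 + norm x) ^ m"
      using real_polynomial_function_bound[OF p] by blast
    obtain B where B: "\<And>y. (1 + norm y) ^ (k + m) * gaussian t x y \<le> B"
      using power_times_gaussian_bounded[OF assms] by blast
    have "C * (1 + norm (0::'a)) ^ m \<ge> 0" using C[of 0] by linarith
    then have C0: "C \<ge> 0" by simp
    have "(1 + norm y) ^ k * norm (h y) \<le> C * B" for y
    proof -
      have "(1 + norm y) ^ k * norm (h y) = (1 + norm y) ^ k * gaussian t x y * \<bar>p y\<bar>"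
        unfolding h by (simp add: abs_mult gaussian_pos less_imp_le mult_ac norm_mult)
      also have "\<dots> \<le> (1 + norm y) ^ k * gaussian t x y * (C * (1 + norm y) ^ m)"
        by (intro mult_left_mono C) (simp add: gaussian_pos less_imp_le)
      also have "\<dots> = C * ((1 + norm y) ^ (k + m) * gaussian t x y)"
        by (simp add: power_add)
      also have "\<dots> \<le> C * B" by (intro mult_left_mono B C0)
      finally show ?thesis .
    qed
    then show ?thesis by blast
  qed
qed

section \<open>Integrals of products of functions of one coordinate\<close>

lemma
  fixes f :: "'a::euclidean_space \<Rightarrow> real \<Rightarrow> 'b::{real_normed_field,banach,second_countable_topology}"
  assumes f: "\<And>b. b \<in> Basis \<Longrightarrow> integrable lborel (f b)"
  shows integrable_lborel_prod: "integrable lborel (\<lambda>x::'a. \<Prod>b\<in>Basis. f b (x \<bullet> b))"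
    and integral_lborel_prod:
      "(LINT x|lborel. (\<Prod>b\<in>Basis. f b (x \<bullet> b))) = (\<Prod>b\<in>Basis. (LINT s|lborel. f b s))"
proof -
  interpret product_sigma_finite "\<lambda>_::'a. lborel :: real measure" ..
  have [measurable]: "f b \<in> borel_measurable borel" if "b \<in> Basis" for b
    using f[OF that] by auto
  have coord: "(\<Prod>b\<in>Basis. f b ((\<Sum>c\<in>Basis. g c *\<^sub>R c) \<bullet> b)) = (\<Prod>b\<in>Basis. f b (g b))" for g :: "'a \<Rightarrow> real"
    by (intro prod.cong) (auto simp: inner_sum_left inner_Basis if_distrib cong: if_cong)
  show "integrable lborel (\<lambda>x::'a. \<Prod>b\<in>Basis. f b (x \<bullet> b))"
    unfolding lborel_eq[where 'a = 'a]
    by (subst integrable_distr_eq) (auto simp: coord intro!: product_integrable_prod f)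
  show "(LINT x|lborel. (\<Prod>b\<in>Basis. f b (x \<bullet> b))) = (\<Prod>b\<in>Basis. (LINT s|lborel. f b s))"
    unfolding lborel_eq[where 'a = 'a]
    by (subst integral_distr) (auto simp: coord intro!: product_integral_prod f)
qed

lemma lborel_integral_affine:
  fixes f :: "'a::euclidean_space \<Rightarrow> 'b::{banach,second_countable_topology}"
  assumes [measurable]: "f \<in> borel_measurable borel" and "c > 0"
  shows "(LINT x|lborel. f x) = c ^ DIM('a) *\<^sub>R (LINT x|lborel. f (t + c *\<^sub>R x))"
  using assms(2)
  by (subst lborel_affine[of c t]) (auto simp: integral_density integral_distr)

lemma
  fixes f :: "'a::euclidean_space \<Rightarrow> 'b::{banach,second_countable_topology}"
  assumes [measurable]: "f \<in> borel_measurable borel"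
  shows lborel_integral_shift: "(LINT x|lborel. f (x + c)) = (LINT x|lborel. f x)"
    and lborel_integrable_shift: "integrable lborel (\<lambda>x. f (x + c)) \<longleftrightarrow> integrable lborel f"
proof -
  show "(LINT x|lborel. f (x + c)) = (LINT x|lborel. f x)"
    using lborel_integral_affine[of f 1 c] by (simp add: add.commute)
  have "integrable (distr lborel borel ((+) c)) f \<longleftrightarrow> integrable lborel (\<lambda>x. f (c + x))"
    by (rule integrable_distr_eq) auto
  then show "integrable lborel (\<lambda>x. f (x + c)) \<longleftrightarrow> integrable lborel f"
    by (simp add: lborel_distr_plus add.commute)
qed

text \<open>
  An integrable majorant for rapidly decreasing functions. It is a product of functions of one
  coordinate, so that its integrability reduces to that of \<open>1 / (1 + s\<^sup>2)\<close> on the line.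
\<close>
definition weight :: "'a::euclidean_space \<Rightarrow> real" where
  "weight y = (\<Prod>b\<in>Basis. 1 / (1 + (y \<bullet> b)\<^sup>2))"

lemma integrable_weight: "integrable lborel (weight :: 'a::euclidean_space \<Rightarrow> real)"
proof -
  have "integrable lborel (\<lambda>s::real. 1 / (1 + s\<^sup>2))"
    using integrable_inverse_1_plus_square
    by (simp add: set_integrable_def einterval_def inverse_eq_divide)
  then show ?thesis
    unfolding weight_def[abs_def] by (intro integrable_lborel_prod)
qed

lemma weight_ge: "1 \<le> (1 + norm y) ^ (2 * DIM('a)) * weight (y::'a::euclidean_space)"
proof -
  have "1 \<le> (\<Prod>b\<in>(Basis::'a set). (1 + norm y)\<^sup>2 * (1 / (1 + (y \<bullet> b)\<^sup>2)))"
  proof (rule prod_ge_1)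
    fix b :: 'a assume "b \<in> Basis"
    then have "(y \<bullet> b)\<^sup>2 \<le> (norm y)\<^sup>2"
      using Basis_le_norm[of b y] by (metis abs_le_square_iff abs_norm_cancel)
    moreover have "1 + (norm y)\<^sup>2 \<le> (1 + norm y)\<^sup>2"
      by (simp add: power2_sum)
    ultimately have "1 + (y \<bullet> b)\<^sup>2 \<le> (1 + norm y)\<^sup>2" by linarith
    moreover have "0 < 1 + (y \<bullet> b)\<^sup>2" by (simp add: add_pos_nonneg)
    ultimately show "1 \<le> (1 + norm y)\<^sup>2 * (1 / (1 + (y \<bullet> b)\<^sup>2))"
      by (simp add: field_simps)
  qed
  also have "\<dots> = (1 + norm y) ^ (2 * DIM('a)) * weight y"
    by (simp only: prod.distrib weight_def prod_constant power_mult)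
  finally show ?thesis .
qed

lemma weight_nonneg: "0 \<le> weight y"
  unfolding weight_def by (intro prod_nonneg) auto

lemma norm_le_weight:
  fixes y :: "'a::euclidean_space" and z :: "'b::real_normed_vector"
  assumes "(1 + norm y) ^ (2 * DIM('a)) * norm z \<le> C"
  shows "norm z \<le> C * weight y"
proof -
  have "norm z * 1 \<le> norm z * ((1 + norm y) ^ (2 * DIM('a)) * weight y)"
    by (intro mult_left_mono weight_ge) auto
  also have "\<dots> \<le> C * weight y"
    using mult_right_mono[OF assms weight_nonneg[of y]] by (simp add: mult_ac)
  finally show ?thesis by simp
qed

lemma integrable_rapidly_decreasing:
  fixes f :: "'a::euclidean_space \<Rightarrow> 'b::{banach,second_countable_topology}"
  assumes [measurable]: "f \<in> borel_measurable borel"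
    and decay: "\<And>y. (1 + norm y) ^ (2 * DIM('a)) * norm (f y) \<le> C"
  shows "integrable lborel f"
proof (rule Bochner_Integration.integrable_bound)
  show "integrable lborel (\<lambda>y::'a. C * weight y)"
    by (intro integrable_mult_right integrable_weight)
  show "AE y in lborel. norm (f y) \<le> norm (C * weight y)"
    using norm_le_weight[OF decay] by (intro AE_I2) (metis abs_ge_self order_trans real_norm_def)
qed simp

lemma schwartz_borel_measurable: "schwartz f \<Longrightarrow> f \<in> borel_measurable borel"
  by (intro borel_measurable_continuous_onI schwartz_continuous)

lemma schwartz_integrable: "schwartz f \<Longrightarrow> integrable lborel f"
  using schwartz_decay[of f "2 * DIM('a)" for f :: "'a::euclidean_space \<Rightarrow> complex"]
  by (metis integrable_rapidly_decreasing schwartz_borel_measurable)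

section \<open>Gaussian integrals\<close>

lemma
  fixes c t :: real
  assumes "t > 0"
  shows integrable_exp_square: "integrable lborel (\<lambda>s::real. exp (- t * (s - c)\<^sup>2))"
    and integral_exp_square: "(LINT s|lborel. exp (- t * (s - c)\<^sup>2)) = sqrt (pi / t)"
proof -
  define \<sigma> where "\<sigma> = sqrt (1 / (2 * t))"
  have sq: "\<sigma>\<^sup>2 = 1 / (2 * t)" using assms by (simp add: \<sigma>_def)
  have pos: "\<sigma> > 0" using assms by (simp add: \<sigma>_def)
  have eq: "(\<lambda>s. exp (- t * (s - c)\<^sup>2)) = (\<lambda>s. sqrt (pi / t) * normal_density c \<sigma> s)"
    using assms by (auto simp: normal_density_def sq real_sqrt_divide real_sqrt_mult field_simps)
  show "integrable lborel (\<lambda>s::real. exp (- t * (s - c)\<^sup>2))"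
    unfolding eq using pos by (intro integrable_mult_right integrable_normal_density)
  show "(LINT s|lborel. exp (- t * (s - c)\<^sup>2)) = sqrt (pi / t)"
    unfolding eq using pos by simp
qed

lemma gaussian_prod: "gaussian t x y = (\<Prod>b\<in>Basis. exp (- t * (y \<bullet> b - x \<bullet> b)\<^sup>2))"
proof -
  have "(norm (y - x))\<^sup>2 = (\<Sum>b\<in>Basis. (y \<bullet> b - x \<bullet> b)\<^sup>2)"
    unfolding power2_norm_eq_inner
    by (subst euclidean_inner) (simp add: inner_diff_left power2_eq_square)
  then show ?thesis by (simp add: gaussian_def exp_sum sum_distrib_left)
qed

lemma
  fixes x :: "'a::euclidean_space"
  assumes "t > 0"
  shows integrable_gaussian: "integrable lborel (gaussian t x)"
    and integral_gaussian: "(LINT y|lborel. gaussian t x y) = sqrt (pi / t) ^ DIM('a)"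
  unfolding gaussian_prod
  using integrable_lborel_prod[OF integrable_exp_square[OF assms]]
    integral_lborel_prod[OF integrable_exp_square[OF assms]] integral_exp_square[OF assms]
  by auto

lemma borel_measurable_gaussian [measurable]:
  "gaussian t x \<in> borel_measurable borel"
  by (intro borel_measurable_continuous_onI continuous_gaussian)

lemma borel_measurable_cis [measurable]: "cis \<in> borel_measurable borel"
  by (intro borel_measurable_continuous_onI continuous_intros)

lemma integral_exp_square_cis:
  fixes u t :: real
  assumes "t > 0"
  shows "(LINT s|lborel. complex_of_real (exp (- (1 / (4 * t)) * s\<^sup>2)) * cis (u * s))
    = of_real (sqrt (4 * pi * t) * exp (- t * u\<^sup>2))"
proof -
  define c where "c = sqrt (2 * t)"
  have c: "c > 0" "c\<^sup>2 = 2 * t" using assms by (auto simp: c_def)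
  have "complex_of_real (exp (- ((u * c)\<^sup>2) / 2)) = char std_normal_distribution (u * c)"
    by (simp add: char_std_normal_distribution)
  also have "\<dots> = (LINT x|lborel. std_normal_density x *\<^sub>R iexp (u * c * x))"
    unfolding char_def by (subst integral_density) auto
  also have "\<dots> = (LINT x|lborel. complex_of_real (1 / sqrt (2 * pi)) *
      (complex_of_real (exp (- (1 / (4 * t)) * (0 + c * x)\<^sup>2)) * cis (u * (0 + c * x))))"
    using assms
    by (intro Bochner_Integration.integral_cong)
      (auto simp: std_normal_density_def scaleR_conv_of_real cis_conv_exp power_mult_distrib c mult_ac)
  also have "\<dots> = complex_of_real (1 / sqrt (2 * pi)) *
      (LINT x|lborel. complex_of_real (exp (- (1 / (4 * t)) * (0 + c * x)\<^sup>2)) * cis (u * (0 + c * x)))"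
    by simp
  finally have *: "(LINT x|lborel. complex_of_real (exp (- (1 / (4 * t)) * (0 + c * x)\<^sup>2)) * cis (u * (0 + c * x)))
      = of_real (sqrt (2 * pi) * exp (- ((u * c)\<^sup>2) / 2))"
    by (simp add: field_simps)
  have "c * sqrt (2 * pi) = sqrt (4 * pi * t)"
    by (simp add: c_def real_sqrt_mult[symmetric] mult_ac)
  then have "c * (sqrt (2 * pi) * exp (- ((u * c)\<^sup>2) / 2)) = sqrt (4 * pi * t) * exp (- t * u\<^sup>2)"
    using c by (simp add: power_mult_distrib mult_ac)
  then have "c *\<^sub>R complex_of_real (sqrt (2 * pi) * exp (- ((u * c)\<^sup>2) / 2))
      = of_real (sqrt (4 * pi * t) * exp (- t * u\<^sup>2))"
    unfolding scaleR_conv_of_real of_real_mult[symmetric] by (rule arg_cong)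
  then show ?thesis
    using c by (subst lborel_integral_real_affine[of c _ 0], simp, subst *) simp
qed

lemma cis_inner: "cis (u \<bullet> y) = (\<Prod>b\<in>Basis. cis ((u \<bullet> b) * (y \<bullet> b)))"
  by (subst euclidean_inner) (simp add: cis_conv_exp sum_distrib_left exp_sum)

lemma fourier_gaussian:
  fixes u :: "'a::euclidean_space"
  assumes "t > 0"
  shows "(LINT y|lborel. complex_of_real (gaussian (1 / (4 * t)) 0 y) * cis (u \<bullet> y))
    = of_real (sqrt (4 * pi * t) ^ DIM('a) * gaussian t 0 u)"
proof -
  let ?f = "\<lambda>b s. complex_of_real (exp (- (1 / (4 * t)) * s\<^sup>2)) * cis ((u \<bullet> b) * s)"
  have int: "integrable lborel (?f b)" for b
  proof (rule Bochner_Integration.integrable_bound)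
    show "integrable lborel (\<lambda>s. exp (- (1 / (4 * t)) * s\<^sup>2))"
      by (rule integrable_exp_square[of "1 / (4 * t)" 0, unfolded diff_zero]) (use assms in simp)
    show "AE s in lborel. norm (?f b s) \<le> norm (exp (- (1 / (4 * t)) * s\<^sup>2))"
      by (simp add: norm_mult)
  qed measurable
  have "(LINT y|lborel. complex_of_real (gaussian (1 / (4 * t)) 0 y) * cis (u \<bullet> y))
      = (LINT y|lborel. (\<Prod>b\<in>Basis. ?f b (y \<bullet> b)))"
  proof (rule Bochner_Integration.integral_cong[OF refl])
    fix y :: 'a
    show "complex_of_real (gaussian (1 / (4 * t)) 0 y) * cis (u \<bullet> y) = (\<Prod>b\<in>Basis. ?f b (y \<bullet> b))"
      unfolding prod.distrib cis_inner[symmetric] gaussian_prod by simp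
  qed
  also have "\<dots> = (\<Prod>b\<in>(Basis::'a set). of_real (sqrt (4 * pi * t) * exp (- t * (u \<bullet> b)\<^sup>2)))"
    unfolding integral_lborel_prod[of ?f, OF int] integral_exp_square_cis[OF assms] ..
  also have "\<dots> = of_real (sqrt (4 * pi * t) ^ DIM('a) * gaussian t 0 u)"
    unfolding gaussian_prod of_real_prod[symmetric] prod.distrib by simp
  finally show ?thesis .
qed

section \<open>Gaussian averages\<close>

definition gaussian_average :: "real \<Rightarrow> ('a::euclidean_space \<Rightarrow> complex) \<Rightarrow> 'a \<Rightarrow> complex" where
  "gaussian_average t f x =
     of_real (sqrt (t / pi) ^ DIM('a)) * (LINT y|lborel. f y * of_real (gaussian t x y))"

lemma gaussian_average_rescaled:
  fixes f :: "'a::euclidean_space \<Rightarrow> complex"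
  assumes [measurable]: "f \<in> borel_measurable borel" and t: "t > 0"
  shows "gaussian_average t f x =
    of_real (sqrt (1 / pi) ^ DIM('a)) * (LINT z|lborel. f (x + (1 / sqrt t) *\<^sub>R z) * of_real (gaussian 1 0 z))"
proof -
  have g: "gaussian t x (x + (1 / sqrt t) *\<^sub>R z) = gaussian 1 0 z" for z
    using t by (simp add: gaussian_def power_mult_distrib power_divide)
  have c: "sqrt (t / pi) ^ DIM('a) * (1 / sqrt t) ^ DIM('a) = sqrt (1 / pi) ^ DIM('a)"
    using t by (simp add: power_mult_distrib[symmetric] real_sqrt_divide)
  show ?thesis
    unfolding gaussian_average_def
    using t by (subst lborel_integral_affine[of _ "1 / sqrt t" x])
      (simp_all only: g, simp_all add: scaleR_conv_of_real c[symmetric])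
qed

lemma gaussian_average_tendsto:
  fixes f :: "'a::euclidean_space \<Rightarrow> complex"
  assumes cont: "continuous_on UNIV f" and bdd: "\<And>y. norm (f y) \<le> B"
    and t: "\<And>k. t k > 0" "filterlim t at_top sequentially"
  shows "(\<lambda>k::nat. gaussian_average (t k) f x) \<longlonglongrightarrow> f x"
proof -
  have [measurable]: "f \<in> borel_measurable borel"
    using cont by (rule borel_measurable_continuous_onI)
  have "(\<lambda>k. LINT z|lborel. f (x + (1 / sqrt (t k)) *\<^sub>R z) * of_real (gaussian 1 0 z))
      \<longlonglongrightarrow> (LINT z|lborel. f x * of_real (gaussian 1 (0::'a) z))"
  proof (rule integral_dominated_convergence[where w = "\<lambda>z. B * gaussian 1 0 z"])
    show "integrable lborel (\<lambda>z::'a. B * gaussian 1 0 z)"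
      by (intro integrable_mult_right integrable_gaussian) simp
    have "(\<lambda>k. 1 / sqrt (t k)) \<longlonglongrightarrow> 0"
      by (intro real_tendsto_divide_at_top[OF tendsto_const] filterlim_compose[OF sqrt_at_top t(2)])
    then have "(\<lambda>k. x + (1 / sqrt (t k)) *\<^sub>R z) \<longlonglongrightarrow> x + 0 *\<^sub>R z" for z
      by (intro tendsto_intros)
    then have "(\<lambda>k. f (x + (1 / sqrt (t k)) *\<^sub>R z)) \<longlonglongrightarrow> f x" for z
      using cont by (intro continuous_on_tendsto_compose[OF cont]) auto
    then show "AE z in lborel. (\<lambda>k. f (x + (1 / sqrt (t k)) *\<^sub>R z) * of_real (gaussian 1 0 z))
        \<longlonglongrightarrow> f x * of_real (gaussian 1 0 z)"
      by (intro AE_I2 tendsto_intros)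
    show "AE z in lborel. norm (f (x + (1 / sqrt (t k)) *\<^sub>R z) * complex_of_real (gaussian 1 0 z))
        \<le> B * gaussian 1 0 z" for k
      by (intro AE_I2) (auto simp: norm_mult gaussian_pos less_imp_le intro!: mult_right_mono bdd)
  qed auto
  then have "(\<lambda>k. gaussian_average (t k) f x)
      \<longlonglongrightarrow> of_real (sqrt (1 / pi) ^ DIM('a)) * (LINT z|lborel. f x * of_real (gaussian 1 (0::'a) z))"
    using t(1) by (simp only: gaussian_average_rescaled[OF \<open>f \<in> borel_measurable borel\<close>] tendsto_mult_left)
  also have "of_real (sqrt (1 / pi) ^ DIM('a)) * (LINT z|lborel. f x * of_real (gaussian 1 (0::'a) z)) = f x"
    by (simp add: integral_gaussian power_mult_distrib[symmetric] real_sqrt_divide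
        of_real_mult[symmetric] of_real_power[symmetric] del: of_real_mult of_real_power)
  finally show ?thesis .
qed

section \<open>Integration by parts\<close>

lemma integrable_pair_mult:
  fixes f :: "'a::euclidean_space \<Rightarrow> real" and g :: "'b::euclidean_space \<Rightarrow> real"
  assumes f: "integrable lborel f" and g: "integrable lborel g"
  shows "integrable (lborel \<Otimes>\<^sub>M lborel) (\<lambda>(x, y). f x * g y)"
proof -
  have [measurable]: "f \<in> borel_measurable borel" "g \<in> borel_measurable borel"
    using f g by auto
  show ?thesis
  proof (rule lborel_pair.Fubini_integrable)
    show "integrable lborel (\<lambda>x. LINT y|lborel. norm (case (x, y) of (x, y) \<Rightarrow> f x * g y))"
      using f by (simp add: abs_mult)
    show "AE x in lborel. integrable lborel (\<lambda>y. case (x, y) of (x, y) \<Rightarrow> f x * g y)"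
      using g by simp
  qed measurable
qed

lemma differentiable_along_line:
  assumes "f differentiable (at (y + s *\<^sub>R v))"
  shows "((\<lambda>s. f (y + s *\<^sub>R v)) has_vector_derivative partial v f (y + s *\<^sub>R v)) (at s)"
proof -
  let ?D = "frechet_derivative f (at (y + s *\<^sub>R v))"
  have D: "(f has_derivative ?D) (at (y + s *\<^sub>R v))"
    using assms frechet_derivative_works by blast
  have "((\<lambda>s. y + s *\<^sub>R v) has_derivative (\<lambda>h. h *\<^sub>R v)) (at s)"
    by (auto intro!: derivative_eq_intros)
  from has_derivative_compose[OF this D]
  have "((\<lambda>s. f (y + s *\<^sub>R v)) has_derivative (\<lambda>h. ?D (h *\<^sub>R v))) (at s)" .
  then show ?thesis
    unfolding has_vector_derivative_def partial_def
    using linear_scale[OF has_derivative_linear[OF D]] by simp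
qed

text \<open>
  The fundamental theorem of calculus along the segments from \<open>y\<close> to \<open>y + v\<close>, integrated over \<open>y\<close>.
  With \<open>u = 1\<close> the left-hand side vanishes by translation invariance, which yields integration by
  parts. With a general \<open>u\<close> it bounds the increments of a convolution by its derivative without
  differentiation under the integral sign.
\<close>
lemma integral_increment:
  fixes u F :: "'a::euclidean_space \<Rightarrow> complex"
  assumes diff: "\<And>y. F differentiable (at y)"
    and cont: "continuous_on UNIV (partial v F)"
    and u [measurable]: "u \<in> borel_measurable borel"
    and H: "\<And>y s. 0 \<le> s \<Longrightarrow> s \<le> 1 \<Longrightarrow> norm (partial v F (y + s *\<^sub>R v)) \<le> H y"
    and int: "integrable lborel (\<lambda>y. norm (u y) * H y)"
  shows "(LINT y|lborel. u y * (F (y + v) - F y))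
    = (LINT s:{0..1}|lborel. (LINT y|lborel. u y * partial v F (y + s *\<^sub>R v)))"
proof -
  let ?G = "\<lambda>y s. indicator {0..1::real} s *\<^sub>R (u y * partial v F (y + s *\<^sub>R v))"
  have [measurable]: "partial v F \<in> borel_measurable borel"
    using cont by (rule borel_measurable_continuous_onI)
  have line: "continuous_on {0..1} (\<lambda>s. partial v F (y + s *\<^sub>R v))" for y
    by (rule continuous_on_compose2[OF cont]) (auto intro!: continuous_intros)
  have ftc: "u y * (F (y + v) - F y) = (LINT s|lborel. ?G y s)" for y
  proof -
    have "(LINT s|lborel. indicator {0..1} s *\<^sub>R partial v F (y + s *\<^sub>R v))
        = F (y + 1 *\<^sub>R v) - F (y + 0 *\<^sub>R v)"
      using diff line
      by (intro integral_FTC_atLeastAtMost[where F = "\<lambda>s. F (y + s *\<^sub>R v)"])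
        (auto intro: differentiable_along_line has_vector_derivative_at_within)
    then have "u y * (F (y + v) - F y)
        = u y * (LINT s|lborel. indicator {0..1} s *\<^sub>R partial v F (y + s *\<^sub>R v))"
      by simp
    also have "\<dots> = (LINT s|lborel. u y * (indicator {0..1} s *\<^sub>R partial v F (y + s *\<^sub>R v)))"
      by (rule integral_mult_right_zero[symmetric])
    finally show ?thesis by simp
  qed
  have "integrable (lborel \<Otimes>\<^sub>M lborel) (case_prod ?G)"
  proof (rule Bochner_Integration.integrable_bound)
    show "integrable (lborel \<Otimes>\<^sub>M lborel) (\<lambda>(y, s). (norm (u y) * H y) * indicator {0..1::real} s)"
      by (intro integrable_pair_mult int) auto
    have "norm (case_prod ?G p) \<le> norm (case p of (y, s) \<Rightarrow> (norm (u y) * H y) * indicator {0..1::real} s)" for p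
      using H[of "snd p" "fst p"]
      by (auto simp: split_beta indicator_def norm_mult abs_mult intro!: mult_left_mono
          intro: order_trans[OF _ abs_ge_self])
    then show "AE p in lborel \<Otimes>\<^sub>M lborel. norm (case_prod ?G p)
        \<le> norm (case p of (y, s) \<Rightarrow> (norm (u y) * H y) * indicator {0..1::real} s)"
      by (intro AE_I2)
  qed measurable
  from lborel_pair.Fubini_integral[OF this]
  show ?thesis
    unfolding ftc set_lebesgue_integral_def by (simp flip: integral_scaleR_right)
qed

lemma integral_partial_zero:
  fixes f :: "'a::euclidean_space \<Rightarrow> complex"
  assumes diff: "\<And>y. f differentiable (at y)"
    and cont: "continuous_on UNIV (partial b f)"
    and decay: "\<And>y. (1 + norm y) ^ (2 * DIM('a)) * norm (partial b f y) \<le> C"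
    and f: "integrable lborel f" and b: "b \<in> Basis"
  shows "(LINT y|lborel. partial b f y) = 0"
proof -
  have [measurable]: "partial b f \<in> borel_measurable borel" "f \<in> borel_measurable borel"
    using cont f by (auto intro: borel_measurable_continuous_onI)
  have H: "norm (partial b f (y + s *\<^sub>R b)) \<le> (2 ^ (2 * DIM('a)) * C) * weight y" if "0 \<le> s" "s \<le> 1" for y s
  proof (rule norm_le_weight)
    have "norm (s *\<^sub>R b) \<le> 1"
      using that b by simp
    have "norm y \<le> norm (y + s *\<^sub>R b) + norm (s *\<^sub>R b)"
      by (metis add_diff_cancel_right' norm_triangle_ineq4)
    have "1 + norm y \<le> 2 * (1 + norm (y + s *\<^sub>R b))"
    proof -
      have "1 + p \<le> 2 * (1 + q)" if "r \<le> 1" "p \<le> q + r" "0 \<le> q" for p q r :: real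
        using that by (simp add: algebra_simps)
      from this[OF \<open>norm (s *\<^sub>R b) \<le> 1\<close>] show ?thesis
        using \<open>norm y \<le> norm (y + s *\<^sub>R b) + norm (s *\<^sub>R b)\<close> by simp
    qed
    then have "(1 + norm y) ^ (2 * DIM('a)) \<le> (2 * (1 + norm (y + s *\<^sub>R b))) ^ (2 * DIM('a))"
      by (intro power_mono) auto
    then have "(1 + norm y) ^ (2 * DIM('a)) * norm (partial b f (y + s *\<^sub>R b))
        \<le> (2 * (1 + norm (y + s *\<^sub>R b))) ^ (2 * DIM('a)) * norm (partial b f (y + s *\<^sub>R b))"
      by (rule mult_right_mono) simp
    also have "\<dots> = 2 ^ (2 * DIM('a)) * ((1 + norm (y + s *\<^sub>R b)) ^ (2 * DIM('a)) * norm (partial b f (y + s *\<^sub>R b)))"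
      by (simp only: power_mult_distrib mult.assoc)
    also have "\<dots> \<le> 2 ^ (2 * DIM('a)) * C"
      by (intro mult_left_mono decay) auto
    finally show "(1 + norm y) ^ (2 * DIM('a)) * norm (partial b f (y + s *\<^sub>R b)) \<le> 2 ^ (2 * DIM('a)) * C" .
  qed
  have "(LINT y|lborel. f (y + b) - f y) = 0"
    using f by (simp add: lborel_integrable_shift lborel_integral_shift)
  also have "(LINT y|lborel. f (y + b) - f y)
      = (LINT s:{0..1}|lborel. (LINT y|lborel. partial b f (y + s *\<^sub>R b)))"
    using integral_increment[where u = "\<lambda>_. 1", OF diff cont _ H]
    by (simp add: integrable_weight)
  also have "\<dots> = (LINT y|lborel. partial b f y)"
    by (simp add: lborel_integral_shift set_lebesgue_integral_def)
  finally show ?thesis by simp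
qed

lemma schwartz_integral_partial:
  assumes "schwartz f" "b \<in> Basis"
  shows "(LINT y|lborel. partial b f y) = 0"
proof -
  obtain C where "\<And>y. (1 + norm y) ^ (2 * DIM('a)) * norm (partial b f y) \<le> C"
    using schwartz_decay[OF schwartz_partial[OF assms]] by blast
  then show ?thesis
    using assms by (intro integral_partial_zero schwartz_differentiable schwartz_continuous
        schwartz_partial schwartz_integrable)
qed

lemma integration_by_parts:
  assumes "schwartz f" "schwartz g" "b \<in> Basis"
  shows "(LINT y|lborel. partial b f y * g y) = - (LINT y|lborel. f y * partial b g y)"
proof -
  have "partial b (\<lambda>y. f y * g y) = (\<lambda>y. f y * partial b g y + partial b f y * g y)"
    using assms by (intro ext partial_mult schwartz_differentiable)
  then have "(LINT y|lborel. f y * partial b g y + partial b f y * g y) = 0"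
    using schwartz_integral_partial[OF schwartz_mult[OF assms(1,2)] assms(3)] by simp
  moreover have "integrable lborel (\<lambda>y. f y * partial b g y)" "integrable lborel (\<lambda>y. partial b f y * g y)"
    using assms by (auto intro!: schwartz_integrable schwartz_mult schwartz_partial)
  ultimately show ?thesis by (simp add: eq_neg_iff_add_eq_0 add.commute)
qed

section \<open>Fourier inversion for Schwartz functions\<close>

lemma lebesgue_integral_eq_lborel:
  fixes f :: "'a::euclidean_space \<Rightarrow> complex"
  shows "f \<in> borel_measurable borel \<Longrightarrow> (LINT x|lebesgue. f x) = (LINT x|lborel. f x)"
  by (rule integral_completion) simp

lemma schwartz_fourier_def:
  assumes "schwartz f"
  shows "fourier f \<xi> = of_real (1 / (2 * pi) ^ CARD('n)) *
    (LINT x|lborel. f (x::real^'n::finite) * cis (- (x \<bullet> \<xi>)))"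
proof -
  have [measurable]: "f \<in> borel_measurable borel"
    using assms by (rule schwartz_borel_measurable)
  show ?thesis
    unfolding fourier_def by (subst lebesgue_integral_eq_lborel) auto
qed

lemma schwartz_fourier_integrable:
  assumes "schwartz f"
  shows "integrable lborel (\<lambda>x. f x * cis (- (x \<bullet> \<xi>)))"
proof (rule Bochner_Integration.integrable_bound[OF schwartz_integrable[OF assms]])
  show "AE x in lborel. norm (f x * cis (- (x \<bullet> \<xi>))) \<le> norm (f x)"
    by (simp add: norm_mult)
  have [measurable]: "f \<in> borel_measurable borel"
    using assms by (rule schwartz_borel_measurable)
  show "(\<lambda>x. f x * cis (- (x \<bullet> \<xi>))) \<in> borel_measurable lborel" by measurable
qed

lemma fourier_diff:
  assumes "schwartz f" "schwartz g"
  shows "fourier (\<lambda>x. f x - g x) \<xi> = fourier f \<xi> - fourier g \<xi>"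
  using assms
  by (simp add: schwartz_fourier_def schwartz_diff schwartz_fourier_integrable left_diff_distrib
      right_diff_distrib del: of_real_divide)

text \<open>
  The character is not a Schwartz function, so integration by parts is carried out on its product with
  \<open>f\<close>, whose decay is that of \<open>f\<close> because the character has modulus one.
\<close>
lemma fourier_partial:
  fixes f :: "real^'n::finite \<Rightarrow> complex"
  assumes f: "schwartz f" and b: "b \<in> Basis"
  shows "fourier (partial b f) \<xi> = \<i> * of_real (\<xi> \<bullet> b) * fourier f \<xi>"
proof -
  let ?e = "\<lambda>x. cis (- (x \<bullet> \<xi>))"
  have de: "(?e has_derivative (\<lambda>v. - \<i> * of_real (v \<bullet> \<xi>) * ?e x)) (at x)" for x
    by (auto intro!: derivative_eq_intros simp: scaleR_conv_of_real)
  have e: "?e differentiable (at x)" for x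
    using de[of x] by (rule differentiableI)
  have df: "partial b (\<lambda>x. f x * ?e x) = (\<lambda>x. f x * (- \<i> * of_real (b \<bullet> \<xi>) * ?e x) + partial b f x * ?e x)"
    by (subst partial_mult[OF schwartz_differentiable[OF f] e, abs_def]) (simp add: partial_eqI[OF de])
  obtain C D where C: "\<And>x. (1 + norm x) ^ (2 * DIM(real^'n)) * norm (f x) \<le> C"
    and D: "\<And>x. (1 + norm x) ^ (2 * DIM(real^'n)) * norm (partial b f x) \<le> D"
    using schwartz_decay[OF f] schwartz_decay[OF schwartz_partial[OF f b]] by metis
  have "(LINT x|lborel. partial b (\<lambda>x. f x * ?e x) x) = 0"
  proof (rule integral_partial_zero[OF _ _ _ _ b])
    show "(\<lambda>x. f x * ?e x) differentiable (at x)" for x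
      by (intro differentiable_mult e schwartz_differentiable f)
    show "continuous_on UNIV (partial b (\<lambda>x. f x * ?e x))"
      unfolding df by (intro continuous_intros schwartz_continuous schwartz_partial f b)
    show "integrable lborel (\<lambda>x. f x * ?e x)"
      by (rule schwartz_fourier_integrable[OF f])
    show "(1 + norm x) ^ (2 * DIM(real^'n)) * norm (partial b (\<lambda>x. f x * ?e x) x) \<le> \<bar>b \<bullet> \<xi>\<bar> * C + D" for x
    proof -
      let ?w = "(1 + norm x) ^ (2 * DIM(real^'n))"
      have "norm (partial b (\<lambda>x. f x * ?e x) x) \<le> \<bar>b \<bullet> \<xi>\<bar> * norm (f x) + norm (partial b f x)"
        unfolding df by (rule norm_triangle_le) (simp add: norm_mult)
      then have "?w * norm (partial b (\<lambda>x. f x * ?e x) x) \<le> ?w * (\<bar>b \<bullet> \<xi>\<bar> * norm (f x) + norm (partial b f x))"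
        by (rule mult_left_mono) simp
      also have "\<dots> = \<bar>b \<bullet> \<xi>\<bar> * (?w * norm (f x)) + ?w * norm (partial b f x)"
        by (simp add: distrib_left mult_ac)
      also have "\<dots> \<le> \<bar>b \<bullet> \<xi>\<bar> * C + D"
        by (intro add_mono mult_left_mono C D) simp
      finally show ?thesis .
    qed
  qed
  moreover have "integrable lborel (\<lambda>x. f x * (- \<i> * of_real (b \<bullet> \<xi>) * ?e x))"
    using integrable_mult_right[OF schwartz_fourier_integrable[OF f], of "- \<i> * of_real (b \<bullet> \<xi>)" \<xi>]
    by (simp add: mult_ac)
  ultimately have "(LINT x|lborel. f x * (- \<i> * of_real (b \<bullet> \<xi>) * ?e x)) + (LINT x|lborel. partial b f x * ?e x) = 0"
    unfolding df using schwartz_fourier_integrable[OF schwartz_partial[OF f b]] by simp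
  moreover have "(LINT x|lborel. f x * (- \<i> * of_real (b \<bullet> \<xi>) * ?e x))
      = (LINT x|lborel. (- \<i> * of_real (b \<bullet> \<xi>)) * (f x * ?e x))"
    by (intro Bochner_Integration.integral_cong) auto
  ultimately have "(LINT x|lborel. partial b f x * ?e x) = \<i> * of_real (\<xi> \<bullet> b) * (LINT x|lborel. f x * ?e x)"
    by (simp add: inner_commute eq_neg_iff_add_eq_0 add.commute)
  then show ?thesis
    by (simp add: schwartz_fourier_def f b schwartz_partial)
qed

lemma fourier_bounded:
  assumes "schwartz f"
  shows "\<exists>C. \<forall>\<xi>. norm (fourier f \<xi>) \<le> C"
proof -
  have "norm (fourier f \<xi>) \<le> (1 / (2 * pi) ^ CARD('a)) * (LINT x|lborel. norm (f x))" for \<xi>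
  proof -
    have "norm (LINT x|lborel. f x * cis (- (x \<bullet> \<xi>))) \<le> (LINT x|lborel. norm (f x))"
      using schwartz_integrable[OF assms] schwartz_fourier_integrable[OF assms]
      by (intro order_trans[OF integral_norm_bound] integral_mono) (auto simp: norm_mult)
    then show ?thesis
      unfolding schwartz_fourier_def[OF assms] norm_mult norm_of_real
      by (simp add: divide_right_mono)
  qed
  then show ?thesis by blast
qed

text \<open>
  Each factor \<open>1 + \<xi>\<^sub>b\<^sup>2\<close> is the symbol of \<open>1 - \<partial>\<^sub>b\<^sup>2\<close>, which preserves the Schwartz class, so the
  factors can be added one coordinate at a time.
\<close>
lemma fourier_le_weight:
  fixes f :: "real^'n::finite \<Rightarrow> complex"
  assumes "schwartz f"
  shows "\<exists>C. \<forall>\<xi>. norm (fourier f \<xi>) \<le> C * weight \<xi>"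
proof -
  have "\<exists>C. \<forall>\<xi>. (\<Prod>b\<in>B. 1 + (\<xi> \<bullet> b)\<^sup>2) * norm (fourier f \<xi>) \<le> C"
    if "finite B" "B \<subseteq> Basis" "schwartz f" for B and f :: "real^'n \<Rightarrow> complex"
    using that
  proof (induction arbitrary: f)
    case empty
    then show ?case using fourier_bounded by simp
  next
    case (insert b B)
    then have b: "b \<in> Basis" and B: "B \<subseteq> Basis" by auto
    note S = insert.prems(2) schwartz_partial[OF schwartz_partial[OF insert.prems(2) b] b]
    let ?g = "\<lambda>x. f x - partial b (partial b f) x"
    obtain C where C: "\<And>\<xi>. (\<Prod>b\<in>B. 1 + (\<xi> \<bullet> b)\<^sup>2) * norm (fourier ?g \<xi>) \<le> C"
      using insert.IH[OF B schwartz_diff[OF S]] by blast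
    have "norm (fourier ?g \<xi>) = (1 + (\<xi> \<bullet> b)\<^sup>2) * norm (fourier f \<xi>)" for \<xi>
    proof -
      have "fourier ?g \<xi> = of_real (1 + (\<xi> \<bullet> b)\<^sup>2) * fourier f \<xi>"
        by (simp add: fourier_diff S fourier_partial schwartz_partial b algebra_simps power2_eq_square)
      moreover have "norm (complex_of_real (1 + (\<xi> \<bullet> b)\<^sup>2)) = 1 + (\<xi> \<bullet> b)\<^sup>2"
        unfolding norm_of_real by simp
      ultimately show ?thesis by (simp only: norm_mult)
    qed
    then have "(\<Prod>c\<in>insert b B. 1 + (\<xi> \<bullet> c)\<^sup>2) * norm (fourier f \<xi>) \<le> C" for \<xi>
      using C[of \<xi>] insert.hyps by (simp add: mult_ac)
    then show ?case by blast
  qed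
  from this[OF finite_Basis subset_refl assms]
  obtain C where C: "\<And>\<xi>. (\<Prod>b\<in>Basis. 1 + (\<xi> \<bullet> b)\<^sup>2) * norm (fourier f \<xi>) \<le> C" by blast
  have "norm (fourier f \<xi>) \<le> C * weight \<xi>" for \<xi>
  proof -
    have "0 < (\<Prod>b\<in>Basis. 1 + (\<xi> \<bullet> b)\<^sup>2)"
      by (intro prod_pos) (simp add: add_pos_nonneg)
    then show ?thesis
      using C[of \<xi>] by (simp add: weight_def prod_dividef field_simps)
  qed
  then show ?thesis by blast
qed

lemma fourier_measurable:
  assumes "schwartz f"
  shows "fourier f \<in> borel_measurable borel"
proof -
  have [measurable]: "f \<in> borel_measurable borel"
    using assms by (rule schwartz_borel_measurable)
  have "(\<lambda>\<xi>. of_real (1 / (2 * pi) ^ CARD('a)) * (LINT x|lborel. f x * cis (- (x \<bullet> \<xi>)))) \<in> borel_measurable borel"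
    by measurable
  then show ?thesis
    unfolding schwartz_fourier_def[OF assms, abs_def] .
qed

text \<open>
  Inserting a Gaussian factor in the frequency integral makes it absolutely convergent jointly with
  the integral that defines the transform; Fubini's theorem then turns it into a Gaussian average.
\<close>
lemma gaussian_average_fourier:
  fixes f :: "real^'n::finite \<Rightarrow> complex"
  assumes f: "schwartz f" and t: "t > 0"
  shows "(LINT \<xi>|lborel. fourier f \<xi> * cis (x \<bullet> \<xi>) * of_real (gaussian (1 / (4 * t)) 0 \<xi>))
    = gaussian_average t f x"
proof -
  let ?c = "complex_of_real (1 / (2 * pi) ^ CARD('n))"
  let ?g = "\<lambda>\<xi>. complex_of_real (gaussian (1 / (4 * t)) 0 \<xi>)"
  let ?k = "\<lambda>\<xi> y. ?c * f y * (?g \<xi> * cis ((x - y) \<bullet> \<xi>))"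
  have [measurable]: "f \<in> borel_measurable borel"
    using f by (rule schwartz_borel_measurable)
  have cis: "cis (- (y \<bullet> \<xi>)) * cis (x \<bullet> \<xi>) = cis ((x - y) \<bullet> \<xi>)" for y \<xi>
    by (simp add: cis_mult inner_diff_left)
  have "fourier f \<xi> * cis (x \<bullet> \<xi>) * ?g \<xi> = (LINT y|lborel. ?k \<xi> y)" for \<xi>
  proof -
    have "fourier f \<xi> * cis (x \<bullet> \<xi>) * ?g \<xi>
        = (?c * cis (x \<bullet> \<xi>) * ?g \<xi>) * (LINT y|lborel. f y * cis (- (y \<bullet> \<xi>)))"
      unfolding schwartz_fourier_def[OF f] by simp
    also have "\<dots> = (LINT y|lborel. (?c * cis (x \<bullet> \<xi>) * ?g \<xi>) * (f y * cis (- (y \<bullet> \<xi>))))"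
      by (rule integral_mult_right_zero[symmetric])
    also have "\<dots> = (LINT y|lborel. ?k \<xi> y)"
      unfolding cis[symmetric] by (intro Bochner_Integration.integral_cong) auto
    finally show ?thesis .
  qed
  then have "(LINT \<xi>|lborel. fourier f \<xi> * cis (x \<bullet> \<xi>) * ?g \<xi>) = (LINT \<xi>|lborel. (LINT y|lborel. ?k \<xi> y))"
    by simp
  also have "\<dots> = (LINT y|lborel. (LINT \<xi>|lborel. ?k \<xi> y))"
  proof (rule lborel_pair.Fubini_integral)
    have "integrable (lborel \<Otimes>\<^sub>M lborel) (\<lambda>(y, \<xi>). (norm ?c * norm (f y)) * gaussian (1 / (4 * t)) 0 \<xi>)"
      using t by (intro integrable_pair_mult integrable_mult_right integrable_norm schwartz_integrable f
          integrable_gaussian) auto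
    then show "integrable (lborel \<Otimes>\<^sub>M lborel) (\<lambda>(y, \<xi>). ?k \<xi> y)"
    proof (rule Bochner_Integration.integrable_bound)
      have "norm (?k \<xi> y) = (norm ?c * norm (f y)) * gaussian (1 / (4 * t)) 0 \<xi>" for \<xi> y
        by (simp only: norm_mult norm_cis norm_of_real abs_of_pos[OF gaussian_pos] mult_1_right)
      then show "AE p in lborel \<Otimes>\<^sub>M lborel. norm (case p of (y, \<xi>) \<Rightarrow> ?k \<xi> y)
          \<le> norm (case p of (y, \<xi>) \<Rightarrow> (norm ?c * norm (f y)) * gaussian (1 / (4 * t)) 0 \<xi>)"
        by (intro AE_I2) (simp only: split_beta real_norm_def abs_ge_self)
    qed measurable
  qed
  also have "\<dots> = (LINT y|lborel. of_real (sqrt (t / pi) ^ CARD('n)) * (f y * of_real (gaussian t x y)))"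
  proof (rule Bochner_Integration.integral_cong[OF refl])
    fix y
    have n: "DIM(real^'n) = CARD('n)" by simp
    have c: "(1 / (2 * pi) ^ CARD('n)) * sqrt (4 * pi * t) ^ CARD('n) = sqrt (t / pi) ^ CARD('n)"
    proof -
      have "1 / (2 * pi) * sqrt (4 * pi * t) = sqrt (t / pi)"
        using t by (simp add: real_sqrt_mult real_sqrt_divide field_simps)
      then show ?thesis
        by (metis power_mult_distrib power_one_over)
    qed
    have "(LINT \<xi>|lborel. ?k \<xi> y) = ?c * f y * of_real (sqrt (4 * pi * t) ^ CARD('n) * gaussian t 0 (x - y))"
      unfolding integral_mult_right_zero fourier_gaussian[OF t] n ..
    also have "gaussian t 0 (x - y) = gaussian t x y"
      by (simp add: gaussian_def norm_minus_commute)
    finally show "(LINT \<xi>|lborel. ?k \<xi> y) = of_real (sqrt (t / pi) ^ CARD('n)) * (f y * of_real (gaussian t x y))"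
      unfolding c[symmetric] of_real_mult by (simp only: mult_ac)
  qed
  also have "\<dots> = gaussian_average t f x"
    by (simp add: gaussian_average_def)
  finally show ?thesis .
qed

text \<open>
  Both limits as \<open>t\<close> tends to infinity exist: on the side of \<open>x\<close> the averages converge since \<open>f\<close> is
  bounded and continuous, on the frequency side the Gaussian factor is removed by dominated
  convergence since the transform is integrable.
\<close>
lemma fourier_inversion:
  fixes f :: "real^'n::finite \<Rightarrow> complex"
  assumes f: "schwartz f"
  shows "(LINT \<xi>|lborel. fourier f \<xi> * cis (x \<bullet> \<xi>)) = f x"
proof (rule LIMSEQ_unique)
  define t :: "nat \<Rightarrow> real" where "t k = real (Suc k)" for k
  have t: "t k > 0" for k by (simp add: t_def)
  have t_lim: "filterlim t at_top sequentially"
    unfolding t_def[abs_def] of_nat_Suc by real_asymp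
  obtain B where B: "\<And>y. norm (f y) \<le> B"
    using schwartz_decay[OF f, of 0] by auto
  show "(\<lambda>k. gaussian_average (t k) f x) \<longlonglongrightarrow> f x"
    by (rule gaussian_average_tendsto[OF schwartz_continuous[OF f] B t t_lim])
  obtain C where C: "\<And>\<xi>. norm (fourier f \<xi>) \<le> C * weight \<xi>"
    using fourier_le_weight[OF f] by blast
  note [measurable] = fourier_measurable[OF f]
  show "(\<lambda>k. gaussian_average (t k) f x) \<longlonglongrightarrow> (LINT \<xi>|lborel. fourier f \<xi> * cis (x \<bullet> \<xi>))"
    unfolding gaussian_average_fourier[OF f t, symmetric]
  proof (rule integral_dominated_convergence[where w = "\<lambda>\<xi>. C * weight \<xi>"])
    show "integrable lborel (\<lambda>\<xi>::real^'n. C * weight \<xi>)"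
      by (intro integrable_mult_right integrable_weight)
    have "(\<lambda>k. fourier f \<xi> * cis (x \<bullet> \<xi>) * complex_of_real (gaussian (1 / (4 * t k)) 0 \<xi>))
        \<longlonglongrightarrow> fourier f \<xi> * cis (x \<bullet> \<xi>) * complex_of_real (exp (- 0 * (norm \<xi>)\<^sup>2))" for \<xi>
    proof -
      have "(\<lambda>k. 1 / (4 * t k)) \<longlonglongrightarrow> 0"
        unfolding t_def by real_asymp
      then show ?thesis
        unfolding gaussian_def diff_zero by (intro tendsto_intros)
    qed
    then show "AE \<xi> in lborel. (\<lambda>k. fourier f \<xi> * cis (x \<bullet> \<xi>) * complex_of_real (gaussian (1 / (4 * t k)) 0 \<xi>))
        \<longlonglongrightarrow> fourier f \<xi> * cis (x \<bullet> \<xi>)"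
      by simp
    have "norm (fourier f \<xi> * cis (x \<bullet> \<xi>) * complex_of_real (gaussian (1 / (4 * t k)) 0 \<xi>)) \<le> C * weight \<xi>" for k \<xi>
    proof -
      have "norm (fourier f \<xi>) * gaussian (1 / (4 * t k)) 0 \<xi> \<le> norm (fourier f \<xi>) * 1"
        using t[of k] by (intro mult_left_mono gaussian_le_1) auto
      then show ?thesis
        using C[of \<xi>] by (simp add: norm_mult gaussian_pos less_imp_le)
    qed
    then show "AE \<xi> in lborel. norm (fourier f \<xi> * cis (x \<bullet> \<xi>) * complex_of_real (gaussian (1 / (4 * t k)) 0 \<xi>))
        \<le> C * weight \<xi>" for k
      by simp
  qed measurable
qed

section \<open>The model operators as pseudodifferential operators\<close>

lemma partial_const: "partial b (\<lambda>_. c) = (\<lambda>_. 0)"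
  by (intro ext partial_eqI[of _ "\<lambda>_. 0"]) simp

lemma partials_const: "partials bs (\<lambda>_. c) = (\<lambda>_. if bs = [] then c else 0)"
  by (induction bs) (auto simp: partials_def partial_const)

lemma partials_of_linear:
  assumes "bounded_linear L"
  shows "partials (bs @ [b]) (\<lambda>p. complex_of_real (L p)) = (\<lambda>_. if bs = [] then of_real (L b) else 0)"
proof -
  have "partials [b] (\<lambda>p. complex_of_real (L p)) = (\<lambda>_. of_real (L b))"
    unfolding partials_def
    by (auto intro!: partial_eqI bounded_linear_imp_has_derivative bounded_linear_compose[OF bounded_linear_of_real assms])
  then show ?thesis
    unfolding partials_append by (simp add: partials_const)
qed

text \<open>
  The bound on \<open>L\<close> forces it to vanish on the first factor, so that differentiation in \<open>x\<close> gives zero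
  rather than a constant.
\<close>
lemma BS1_symbol_linear:
  fixes L :: "(real^'n::finite) \<times> (real^'n) \<times> (real^'n) \<Rightarrow> real"
  assumes L: "bounded_linear L"
    and bound: "\<And>x \<xi> \<eta>. \<bar>L (x, \<xi>, \<eta>)\<bar> \<le> norm \<xi> + norm \<eta>"
  shows "BS1_symbol (\<lambda>p. complex_of_real (L p))"
proof -
  have "partials bs (\<lambda>p. complex_of_real (L p)) differentiable (at p)" for bs p
  proof (cases bs rule: rev_cases)
    case Nil
    then show ?thesis
      using bounded_linear_imp_differentiable[OF bounded_linear_compose[OF bounded_linear_of_real L]]
      by (simp add: partials_def)
  qed (simp add: partials_of_linear[OF L])
  then have smooth: "smooth (\<lambda>p. complex_of_real (L p))"
    by (simp add: smooth_def)
  have "\<exists>C. \<forall>x \<xi> \<eta>. norm (partials (map (\<lambda>j. (axis j 1, 0, 0)) \<alpha> @ map (\<lambda>j. (0, axis j 1, 0)) \<beta> @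
          map (\<lambda>j. (0, 0, axis j 1)) \<gamma>) (\<lambda>p. complex_of_real (L p)) (x, \<xi>, \<eta>))
      \<le> C * (1 + norm \<xi> + norm \<eta>) powr (1 - real (length \<beta>) - real (length \<gamma>))"
    for \<alpha> \<beta> \<gamma> :: "'n list"
  proof -
    let ?A = "map (\<lambda>j. (axis j 1, 0, 0)) \<alpha> :: ((real^'n) \<times> (real^'n) \<times> (real^'n)) list"
    let ?B = "map (\<lambda>j. (0, axis j 1, 0)) \<beta> :: ((real^'n) \<times> (real^'n) \<times> (real^'n)) list"
    let ?C = "map (\<lambda>j. (0, 0, axis j 1)) \<gamma> :: ((real^'n) \<times> (real^'n) \<times> (real^'n)) list"
    have pos: "1 + norm \<xi> + norm \<eta> > 0" for \<xi> \<eta> :: "real^'n"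
      by (simp add: add_pos_nonneg)
    show ?thesis
    proof (cases "?A @ ?B @ ?C" rule: rev_cases)
      case Nil
      then have nil: "\<alpha> = []" "\<beta> = []" "\<gamma> = []" by auto
      have "\<bar>L (x, \<xi>, \<eta>)\<bar> \<le> 1 * (1 + norm \<xi> + norm \<eta>) powr 1" for x \<xi> \<eta>
        using bound[of x \<xi> \<eta>] pos[of \<xi> \<eta>] by simp
      then show ?thesis
        unfolding nil
        by (intro exI[of _ 1]) (simp add: partials_def)
    next
      case (snoc ds d)
      show ?thesis
      proof (cases "ds = [] \<and> \<alpha> = []")
        case True
        then have "length (?B @ ?C) = 1"
          using snoc by (metis append_Nil length_append_singleton list.size(3) list.simps(8) One_nat_def)
        then have "1 - real (length \<beta>) - real (length \<gamma>) = 0" by (simp; linarith)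
        then show ?thesis
          unfolding snoc partials_of_linear[OF L]
          using pos by (intro exI[of _ "\<bar>L d\<bar>"]) (simp add: less_imp_neq[symmetric])
      next
        case False
        have "(if ds = [] then complex_of_real (L d) else 0) = 0"
        proof (cases "ds = []")
          case True
          then have "d \<in> set ?A"
            using False snoc by (cases \<alpha>) auto
          then obtain i where "d = (axis i 1, 0, 0)" by auto
          then show ?thesis using bound[of "axis i 1" 0 0] by simp
        qed simp
        then show ?thesis
          unfolding snoc partials_of_linear[OF L] by (intro exI[of _ 0]) simp
      qed
    qed
  qed
  then show ?thesis
    using smooth unfolding BS1_symbol_def by blast
qed

lemma fourier_inversion_lebesgue:
  fixes f :: "real^'n::finite \<Rightarrow> complex"
  assumes "schwartz f"
  shows "(LINT \<xi>|lebesgue. fourier f \<xi> * cis (x \<bullet> \<xi>)) = f x"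
proof -
  note [measurable] = fourier_measurable[OF assms]
  show ?thesis
    using fourier_inversion[OF assms] by (subst lebesgue_integral_eq_lborel) measurable
qed

lemma fourier_inversion_Dj:
  fixes f :: "real^'n::finite \<Rightarrow> complex"
  assumes f: "schwartz f"
  shows "(LINT \<xi>|lebesgue. of_real (\<xi> $ j) * fourier f \<xi> * cis (x \<bullet> \<xi>)) = Dj j f x"
proof -
  have b: "axis j 1 \<in> (Basis :: (real^'n) set)" by simp
  have "of_real (\<xi> $ j) * fourier f \<xi> * cis (x \<bullet> \<xi>)
      = (- \<i>) * (fourier (partial (axis j 1) f) \<xi> * cis (x \<bullet> \<xi>))" for \<xi>
    by (simp add: fourier_partial[OF f b] inner_axis mult.assoc)
  then show ?thesis
    by (simp only: integral_mult_right_zero fourier_inversion_lebesgue[OF schwartz_partial[OF f b]] Dj_def)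
qed

lemma bilin_psdo_product_symbol:
  "bilin_psdo (\<lambda>(x, \<xi>, \<eta>). m \<xi> * k \<eta>) f g x =
    (LINT \<xi>|lebesgue. m \<xi> * fourier f \<xi> * cis (x \<bullet> \<xi>)) * (LINT \<eta>|lebesgue. k \<eta> * fourier g \<eta> * cis (x \<bullet> \<eta>))"
proof -
  have "m \<xi> * k \<eta> * fourier f \<xi> * fourier g \<eta> * cis (x \<bullet> (\<xi> + \<eta>))
      = (m \<xi> * fourier f \<xi> * cis (x \<bullet> \<xi>)) * (k \<eta> * fourier g \<eta> * cis (x \<bullet> \<eta>))" for \<xi> \<eta>
    by (simp add: inner_add_right flip: cis_mult)
  then show ?thesis
    unfolding bilin_psdo_def by (simp only: prod.case integral_mult_right_zero integral_mult_left_zero)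
qed

lemma T1_in_OpBS1: "T1 j \<in> OpBS1"
proof -
  let ?\<sigma> = "\<lambda>p :: (real^'a) \<times> (real^'a) \<times> (real^'a). complex_of_real (fst (snd p) $ j)"
  have "bounded_linear (\<lambda>p :: (real^'a) \<times> (real^'a) \<times> (real^'a). fst (snd p) $ j)"
    by (intro bounded_linear_compose[OF bounded_linear_vec_nth]
        bounded_linear_compose[OF bounded_linear_fst] bounded_linear_snd)
  then have "BS1_symbol ?\<sigma>"
    by (rule BS1_symbol_linear) (auto intro: order_trans[OF component_le_norm_cart])
  moreover have "T1 j f g = bilin_psdo ?\<sigma> f g" if "schwartz f" "schwartz g" for f g
  proof
    fix x
    have \<sigma>: "?\<sigma> = (\<lambda>(x, \<xi>, \<eta>). complex_of_real (\<xi> $ j) * 1)" by auto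
    show "T1 j f g x = bilin_psdo ?\<sigma> f g x"
      unfolding \<sigma> bilin_psdo_product_symbol T1_def
      by (simp add: fourier_inversion_Dj fourier_inversion_lebesgue that)
  qed
  ultimately show ?thesis unfolding OpBS1_def by blast
qed

lemma T2_in_OpBS1: "T2 j \<in> OpBS1"
proof -
  let ?\<sigma> = "\<lambda>p :: (real^'a) \<times> (real^'a) \<times> (real^'a). complex_of_real (snd (snd p) $ j)"
  have "bounded_linear (\<lambda>p :: (real^'a) \<times> (real^'a) \<times> (real^'a). snd (snd p) $ j)"
    by (intro bounded_linear_compose[OF bounded_linear_vec_nth]
        bounded_linear_compose[OF bounded_linear_snd] bounded_linear_snd)
  then have "BS1_symbol ?\<sigma>"
    by (rule BS1_symbol_linear) (auto intro: order_trans[OF component_le_norm_cart])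
  moreover have "T2 j f g = bilin_psdo ?\<sigma> f g" if "schwartz f" "schwartz g" for f g
  proof
    fix x
    have \<sigma>: "?\<sigma> = (\<lambda>(x, \<xi>, \<eta>). 1 * complex_of_real (\<eta> $ j))" by auto
    show "T2 j f g x = bilin_psdo ?\<sigma> f g x"
      unfolding \<sigma> bilin_psdo_product_symbol T2_def
      by (simp add: fourier_inversion_Dj fourier_inversion_lebesgue that)
  qed
  ultimately show ?thesis unfolding OpBS1_def by blast
qed

section \<open>The commutators of the model operators\<close>

lemma schwartz_integral_lebesgue: "schwartz f \<Longrightarrow> (LINT x|lebesgue. f x) = (LINT x|lborel. f x)"
  by (intro lebesgue_integral_eq_lborel schwartz_borel_measurable)

text \<open>
  The test function \<open>cnj (h - k)\<close> turns the hypothesis into the vanishing of the square integral of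
  \<open>h - k\<close>. This makes the transposes in the definition of the commutators computable.
\<close>
lemma schwartz_eq_if_same_integrals:
  fixes h k :: "real^'n::finite \<Rightarrow> complex"
  assumes h: "schwartz h" and k: "schwartz k"
    and eq: "\<And>f. schwartz f \<Longrightarrow> (LINT x|lebesgue. f x * h x) = (LINT x|lebesgue. f x * k x)"
  shows "h = k"
proof -
  define d where "d x = h x - k x" for x
  have d: "schwartz d" unfolding d_def[abs_def] using h k by (rule schwartz_diff)
  then have c: "schwartz (\<lambda>x. cnj (d x))" by (rule schwartz_cnj)
  have "(LINT x|lborel. cnj (d x) * h x) = (LINT x|lborel. cnj (d x) * k x)"
    using eq[OF c] unfolding schwartz_integral_lebesgue[OF schwartz_mult[OF c h]]
      schwartz_integral_lebesgue[OF schwartz_mult[OF c k]] .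
  then have "(LINT x|lborel. cnj (d x) * h x - cnj (d x) * k x) = 0"
    using schwartz_integrable[OF schwartz_mult[OF c h]] schwartz_integrable[OF schwartz_mult[OF c k]]
    by simp
  moreover have "cnj (d x) * h x - cnj (d x) * k x = complex_of_real ((norm (d x))\<^sup>2)" for x
    unfolding right_diff_distrib[symmetric] d_def[symmetric]
    by (metis complex_norm_square mult.commute)
  ultimately have "(LINT x|lborel. complex_of_real ((norm (d x))\<^sup>2)) = 0"
    by simp
  then have zero: "(LINT x|lborel. (norm (d x))\<^sup>2) = 0"
    unfolding integral_complex_of_real of_real_eq_0_iff .
  have int: "integrable lborel (\<lambda>x. (norm (d x))\<^sup>2)"
    using integrable_norm[OF schwartz_integrable[OF schwartz_mult[OF d d]]]
    by (simp add: norm_mult power2_eq_square)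
  have "AE x in lborel. (norm (d x))\<^sup>2 = 0"
    using zero integral_nonneg_eq_0_iff_AE[OF int] by simp
  then have ae: "AE x in lebesgue. x \<in> {x. d x = 0}"
    by (intro AE_completion) simp
  have "closed {x. d x = 0}"
    using schwartz_continuous[OF d] by (intro closed_Collect_eq continuous_on_const)
  from mem_closed_if_AE_lebesgue[OF this ae]
  show ?thesis by (auto simp: fun_eq_iff d_def)
qed

lemma Dj_schwartz: "schwartz f \<Longrightarrow> schwartz (Dj j f)"
  unfolding Dj_def[abs_def] by (intro schwartz_cmult schwartz_partial) auto

lemma Dj_mult:
  assumes "schwartz f" "schwartz g"
  shows "Dj j (\<lambda>x. f x * g x) x = f x * Dj j g x + Dj j f x * g x"
  unfolding Dj_def using assms
  by (subst partial_mult) (auto simp: schwartz_differentiable algebra_simps)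

lemma Dj_by_parts:
  fixes f h :: "real^'n::finite \<Rightarrow> complex"
  assumes "schwartz f" "schwartz h"
  shows "(LINT x|lebesgue. Dj j f x * h x) = - (LINT x|lebesgue. f x * Dj j h x)"
proof -
  have b: "axis j 1 \<in> (Basis :: (real^'n) set)" by simp
  have "(LINT x|lborel. Dj j f x * h x) = (LINT x|lborel. (- \<i>) * (partial (axis j 1) f x * h x))"
    by (simp add: Dj_def mult.assoc)
  also have "\<dots> = - (LINT x|lborel. (- \<i>) * (f x * partial (axis j 1) h x))"
    unfolding integral_mult_right_zero integration_by_parts[OF assms b] by simp
  also have "\<dots> = - (LINT x|lborel. f x * Dj j h x)"
    by (simp add: Dj_def mult_ac)
  finally show ?thesis
    by (simp add: schwartz_integral_lebesgue schwartz_mult Dj_schwartz assms)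
qed

lemma transpose1_T1:
  assumes g: "schwartz g" and \<phi>: "schwartz \<phi>"
  shows "transpose1 (T1 j) g \<phi> = (\<lambda>x. - 1 * Dj j (\<lambda>x. g x * \<phi> x) x)" (is "_ = ?h")
  unfolding transpose1_def
proof (rule the_equality)
  have S: "schwartz (\<lambda>x. g x * \<phi> x)" using g \<phi> by (rule schwartz_mult)
  have h: "schwartz ?h" by (intro schwartz_cmult Dj_schwartz S)
  have eq: "(LINT x|lebesgue. T1 j f g x * \<phi> x) = (LINT x|lebesgue. f x * ?h x)" if f: "schwartz f" for f
    using Dj_by_parts[OF f S, of j] by (simp add: T1_def mult.assoc)
  show "schwartz ?h \<and> (\<forall>f. schwartz f \<longrightarrow> (LINT x|lebesgue. T1 j f g x * \<phi> x) = (LINT x|lebesgue. f x * ?h x))"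
    using h eq by blast
  show "k = ?h"
    if "schwartz k \<and> (\<forall>f. schwartz f \<longrightarrow> (LINT x|lebesgue. T1 j f g x * \<phi> x) = (LINT x|lebesgue. f x * k x))" for k
  proof (rule schwartz_eq_if_same_integrals)
    show "schwartz k" "schwartz ?h" using that h by auto
    show "(LINT x|lebesgue. f x * k x) = (LINT x|lebesgue. f x * ?h x)" if f: "schwartz f" for f
      using \<open>schwartz k \<and> _\<close> eq[OF f] f by metis
  qed
qed

lemma transpose2_T2:
  "transpose2 (T2 j) f \<phi> = transpose1 (T1 j) f \<phi>"
  unfolding transpose1_def transpose2_def T1_def T2_def by (simp add: mult_ac)

text \<open>
  The derivative in \<open>T\<^sub>j\<close> is moved onto the other factors, so that both terms of the commutator are
  integrals against \<open>a\<close>; by the Leibniz rule they combine into the distribution \<open>D\<^sub>j a\<close> multiplied by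
  \<open>f g\<close>.
\<close>
lemma commutator1_T1:
  fixes a :: "real^'n::finite \<Rightarrow> complex"
  assumes a: "tempered_fun a" and S: "schwartz f" "schwartz g" "schwartz \<phi>"
  shows "commutator1 (T1 j) a f g \<phi> = - (LINT x|lebesgue. a x * Dj j (\<lambda>x. f x * (g x * \<phi> x)) x)"
proof -
  have g\<phi>: "schwartz (\<lambda>x. g x * \<phi> x)" using S by (intro schwartz_mult)
  have int: "integrable lebesgue (\<lambda>x. a x * (f x * Dj j (\<lambda>x. g x * \<phi> x) x))"
    "integrable lebesgue (\<lambda>x. a x * (Dj j f x * (g x * \<phi> x)))"
    using a S g\<phi> unfolding tempered_fun_def by (auto intro: schwartz_mult Dj_schwartz)
  have "commutator1 (T1 j) a f g \<phi> = (LINT x|lebesgue. - (a x * (f x * Dj j (\<lambda>x. g x * \<phi> x) x)))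
      - (LINT x|lebesgue. a x * (Dj j f x * (g x * \<phi> x)))"
    unfolding commutator1_def extend1_def transpose1_T1[OF S(2,3)] T1_def by (simp add: mult.assoc)
  also have "\<dots> = - (LINT x|lebesgue. a x * (f x * Dj j (\<lambda>x. g x * \<phi> x) x) + a x * (Dj j f x * (g x * \<phi> x)))"
    using int by simp
  finally show ?thesis
    by (simp add: Dj_mult[OF S(1) g\<phi>] distrib_left)
qed

lemma commutator2_T2:
  "commutator2 (T2 j) a f g \<phi> = commutator1 (T1 j) a g f \<phi>"
  unfolding commutator1_def commutator2_def extend1_def extend2_def transpose2_T2 T1_def T2_def
  by (simp add: mult_ac)

section \<open>Testing the commutators on Gaussians\<close>

lemma Lp_norm_gaussian_le:
  fixes x :: "real^'n::finite"
  assumes "t > 0" "p \<ge> 1"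
  shows "Lp_norm p (\<lambda>y. complex_of_real (gaussian t x y)) \<le> (sqrt (pi / t) ^ CARD('n)) powr (1 / p)"
proof -
  have eq: "norm (complex_of_real (gaussian t x y)) powr p = gaussian (p * t) x y" for y
    by (simp add: gaussian_def exp_powr_real mult_ac)
  have "(LINT y|lebesgue. norm (complex_of_real (gaussian t x y)) powr p) = sqrt (pi / (p * t)) ^ CARD('n)"
    using assms unfolding eq by (subst integral_completion) (auto simp: integral_gaussian)
  also have "\<dots> \<le> sqrt (pi / t) ^ CARD('n)"
    using assms by (intro power_mono real_sqrt_le_mono divide_left_mono) auto
  finally show ?thesis
    unfolding Lp_norm_def using assms by (intro powr_mono2) auto
qed

text \<open>
  All three functions in the pairing are the same Gaussian. Comparing \<open>\<bar>F\<bar> \<phi>\<close> with \<open>\<phi> + \<bar>F\<bar>\<^sup>r\<close> replaces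
  the inequality of Hoelder, at no loss: both terms scale like \<open>t\<close> to the power \<open>- n / 2\<close>, because
  \<open>1/p + 1/q = 1/r\<close>.
\<close>
lemma bounded_Lp_gaussian:
  fixes B :: "(real^'n::finite \<Rightarrow> complex) \<Rightarrow> (real^'n \<Rightarrow> complex) \<Rightarrow> 'n distr"
  assumes B: "bounded_Lp p q r B" and hoelder: "hoelder_triple p q r"
  defines "G \<equiv> \<lambda>t x y. complex_of_real (gaussian t x y)"
  shows "\<exists>K. \<forall>t>0. \<forall>x. norm (B (G t x) (G t x) (G t x)) \<le> K * sqrt (pi / t) ^ CARD('n)"
proof -
  have pqr: "p \<ge> 1" "q \<ge> 1" "r \<ge> 1" "1 / p + 1 / q = 1 / r"
    using hoelder by (auto simp: hoelder_triple_def)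
  obtain C where C: "\<And>f g. schwartz f \<Longrightarrow> schwartz g \<Longrightarrow> \<exists>F. in_Lp r F \<and>
      (\<forall>\<phi>. schwartz \<phi> \<longrightarrow> B f g \<phi> = (LINT x|lebesgue. F x * \<phi> x)) \<and>
      Lp_norm r F \<le> C * Lp_norm p f * Lp_norm q g"
    using B unfolding bounded_Lp_def by blast
  have "norm (B (G t x) (G t x) (G t x)) \<le> (1 + \<bar>C\<bar> powr r) * sqrt (pi / t) ^ CARD('n)" if t: "t > 0" for t x
  proof -
    define M where "M = sqrt (pi / t) ^ CARD('n)"
    have M: "M > 0" using t by (simp add: M_def)
    have S: "schwartz (G t x)" unfolding G_def using t by (rule schwartz_gaussian)
    obtain F where F: "in_Lp r F" "B (G t x) (G t x) (G t x) = (LINT y|lebesgue. F y * G t x y)"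
      "Lp_norm r F \<le> C * Lp_norm p (G t x) * Lp_norm q (G t x)"
      using C[OF S S] S by metis
    define I where "I = (LINT y|lebesgue. norm (F y) powr r)"
    have I: "I \<ge> 0" unfolding I_def by simp
    have Fint: "integrable lebesgue (\<lambda>y. norm (F y) powr r)" and [measurable]: "F \<in> borel_measurable lebesgue"
      using F(1) by (auto simp: in_Lp_def)
    have Lnn: "0 \<le> Lp_norm s f" for s and f :: "real^'n \<Rightarrow> complex" by (simp add: Lp_norm_def)
    have "I powr (1 / r) \<le> \<bar>C\<bar> * M powr (1 / r)"
    proof -
      have "I powr (1 / r) \<le> C * Lp_norm p (G t x) * Lp_norm q (G t x)"
        using F(3) by (simp add: I_def Lp_norm_def)
      also have "\<dots> \<le> \<bar>C\<bar> * Lp_norm p (G t x) * Lp_norm q (G t x)"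
        by (intro mult_right_mono Lnn) simp
      also have "\<dots> \<le> \<bar>C\<bar> * M powr (1 / p) * M powr (1 / q)"
        unfolding G_def M_def using t pqr
        by (intro mult_mono order_refl Lp_norm_gaussian_le Lnn mult_nonneg_nonneg) auto
      also have "\<dots> = \<bar>C\<bar> * M powr (1 / r)"
        by (simp add: mult.assoc powr_add[symmetric] pqr(4))
      finally show ?thesis .
    qed
    then have "(I powr (1 / r)) powr r \<le> (\<bar>C\<bar> * M powr (1 / r)) powr r"
      using pqr by (intro powr_mono2) auto
    then have I_le: "I \<le> \<bar>C\<bar> powr r * M"
      using I M pqr by (simp add: powr_powr powr_mult)
    have gint: "integrable lebesgue (gaussian t x)"
      using t by (subst integrable_completion) (auto intro: integrable_gaussian)
    have pw: "norm (F y * G t x y) \<le> gaussian t x y + norm (F y) powr r" for y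
    proof (cases "norm (F y) \<le> 1")
      case True
      then have "norm (F y) * gaussian t x y \<le> 1 * gaussian t x y"
        by (intro mult_right_mono) (auto simp: gaussian_pos less_imp_le)
      then show ?thesis
        unfolding G_def norm_mult norm_of_real abs_of_pos[OF gaussian_pos] by (smt (verit) powr_ge_zero)
    next
      case False
      then have "norm (F y) * gaussian t x y \<le> norm (F y) * 1"
        using t by (intro mult_left_mono gaussian_le_1) auto
      also have "norm (F y) * 1 \<le> norm (F y) powr r"
        using powr_mono[of 1 r "norm (F y)"] False pqr by simp
      finally show ?thesis
        unfolding G_def norm_mult norm_of_real abs_of_pos[OF gaussian_pos] using gaussian_pos[of t x y] by linarith
    qed
    have "norm (LINT y|lebesgue. F y * G t x y) \<le> (LINT y|lebesgue. gaussian t x y + norm (F y) powr r)"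
    proof (rule order_trans[OF integral_norm_bound], rule integral_mono')
      show "integrable lebesgue (\<lambda>y. gaussian t x y + norm (F y) powr r)"
        using gint Fint by (rule Bochner_Integration.integrable_add)
    qed (auto simp: gaussian_pos less_imp_le intro: pw)
    also have "\<dots> = M + I"
      using gint Fint t by (simp add: I_def M_def integral_completion integral_gaussian)
    also have "\<dots> \<le> (1 + \<bar>C\<bar> powr r) * M"
      using I_le by (simp add: distrib_right)
    finally show ?thesis by (simp add: F(2) M_def)
  qed
  then show ?thesis by blast
qed

section \<open>Convergence of Gaussian averages\<close>

text \<open>
  A measurable function is almost everywhere a limit of continuous functions. Composing with the
  radial truncation \<open>cut m\<close> of the plane makes dominated convergence applicable, once for the
  truncation of \<open>u\<close> itself and once, at a fixed level \<open>m\<close>, for the approximating functions.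
\<close>
lemma bounded_continuous_approximation:
  fixes u :: "'a::euclidean_space \<Rightarrow> complex"
  assumes u [measurable]: "u \<in> borel_measurable borel" and w: "integrable lborel w" and w0: "\<And>x. 0 \<le> w x"
    and uw: "integrable lborel (\<lambda>x. norm (u x) * w x)" and e: "e > 0"
  obtains h B where "continuous_on UNIV h" "\<And>x. norm (h x) \<le> B"
    "(LINT x|lborel. norm (u x - h x) * w x) < e"
proof -
  have [measurable]: "w \<in> borel_measurable borel" using w by auto
  define cut :: "nat \<Rightarrow> complex \<Rightarrow> complex"
    where "cut m z = ((1 + real m) / max (1 + real m) (norm z)) *\<^sub>R z" for m z
  have pos: "max (1 + real m) (norm z) > 0" for m and z :: complex by (simp add: less_max_iff_disj)
  have cut_cont: "continuous_on UNIV (cut m)" for m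
    unfolding cut_def[abs_def]
  proof (rule continuous_on_scaleR[OF continuous_on_divide])
    show "continuous_on UNIV (\<lambda>z::complex. max (1 + real m) (norm z))"
      by (intro continuous_on_max continuous_on_const continuous_on_norm continuous_on_id)
    show "\<forall>z\<in>UNIV. max (1 + real m) (norm (z::complex)) \<noteq> 0"
      by (intro ballI less_imp_neq[THEN not_sym] pos)
  qed (rule continuous_on_const, rule continuous_on_id)
  then have [measurable]: "cut m \<in> borel_measurable borel" for m
    by (rule borel_measurable_continuous_onI)
  have cut_eq: "cut m z = z" if "norm z \<le> 1 + real m" for m z
    using that by (simp add: cut_def max_absorb1)
  have cut_le: "norm (cut m z) \<le> norm z" "norm (cut m z) \<le> 1 + real m" for m z
  proof -
    have eq: "norm (cut m z) = ((1 + real m) * norm z) / max (1 + real m) (norm z)"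
      using pos[of m z] by (simp add: cut_def)
    have "(1 + real m) * norm z \<le> norm z * max (1 + real m) (norm z)"
      unfolding mult.commute[of _ "norm z"] by (intro mult_left_mono) auto
    then show "norm (cut m z) \<le> norm z"
      unfolding eq pos_divide_le_eq[OF pos] .
    show "norm (cut m z) \<le> 1 + real m"
      unfolding eq pos_divide_le_eq[OF pos] by (intro mult_left_mono) auto
  qed
  have tri1: "norm (z - cut m z) \<le> 2 * norm z" for m z
    by (rule order_trans[OF norm_triangle_ineq4]) (use cut_le(1)[of m z] in simp)
  have tri2: "norm (cut m y - cut m z) \<le> 2 * (1 + real m)" for m y z
    by (rule order_trans[OF norm_triangle_ineq4]) (use cut_le(2)[of m y] cut_le(2)[of m z] in simp)
  have dom1: "norm (norm (u x - cut m (u x)) * w x) \<le> 2 * (norm (u x) * w x)" for m x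
    unfolding real_norm_def abs_mult abs_norm_cancel abs_of_nonneg[OF w0] mult.assoc[symmetric]
    by (intro mult_right_mono tri1 w0)
  have dom2: "norm (norm (cut m (u x) - cut m z) * w x) \<le> (2 * (1 + real m)) * w x" for m x z
    unfolding real_norm_def abs_mult abs_norm_cancel abs_of_nonneg[OF w0]
    by (intro mult_right_mono tri2 w0)
  have "(\<lambda>m. LINT x|lborel. norm (u x - cut m (u x)) * w x) \<longlonglongrightarrow> (LINT x|(lborel :: 'a measure). 0 :: real)"
  proof (rule integral_dominated_convergence[where w = "\<lambda>x. 2 * (norm (u x) * w x)"])
    show "integrable lborel (\<lambda>x. 2 * (norm (u x) * w x))" using uw by (rule integrable_mult_right)
    have "(\<lambda>m. norm (u x - cut m (u x)) * w x) \<longlonglongrightarrow> 0" for x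
    proof (rule tendsto_eventually)
      obtain M :: nat where "norm (u x) \<le> real M" using real_arch_simple by blast
      then have "norm (u x) \<le> 1 + real m" if "m \<ge> M" for m
        using that by linarith
      then show "\<forall>\<^sub>F m in sequentially. norm (u x - cut m (u x)) * w x = 0"
        by (intro eventually_sequentiallyI[of M]) (simp add: cut_eq)
    qed
    then show "AE x in lborel. (\<lambda>m. norm (u x - cut m (u x)) * w x) \<longlonglongrightarrow> 0" by (rule AE_I2)
    show "AE x in lborel. norm (norm (u x - cut m (u x)) * w x) \<le> 2 * (norm (u x) * w x)" for m
      by (intro AE_I2 dom1)
  qed measurable
  then have "\<forall>\<^sub>F m in sequentially. (LINT x|lborel. norm (u x - cut m (u x)) * w x) < e / 2"
    using e by (intro order_tendstoD(2)) auto
  then obtain m where m: "(LINT x|lborel. norm (u x - cut m (u x)) * w x) < e / 2"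
    using eventually_happens'[OF sequentially_bot] by blast
  have "u \<in> borel_measurable lebesgue" by (intro measurable_completion) simp
  then have "u measurable_on UNIV" by (rule lebesgue_measurable_imp_measurable_on) simp
  then obtain N g where N: "negligible N" and g: "\<And>n. continuous_on UNIV (g n)"
    and lim: "\<And>x. x \<notin> N \<Longrightarrow> (\<lambda>n::nat. g n x) \<longlonglongrightarrow> u x"
    unfolding measurable_on_def by auto
  have ae: "AE x in lborel. x \<notin> N"
    using N by (subst AE_completion_iff[symmetric]) (intro AE_not_in, simp add: negligible_iff_null_sets)
  have gc: "continuous_on UNIV (\<lambda>x. cut m (g n x))" for n
    using continuous_on_compose2[OF cut_cont g] by blast
  then have [measurable]: "(\<lambda>x. cut m (g n x)) \<in> borel_measurable borel" for n
    by (rule borel_measurable_continuous_onI)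
  have "(\<lambda>n. LINT x|lborel. norm (cut m (u x) - cut m (g n x)) * w x) \<longlonglongrightarrow> (LINT x|(lborel :: 'a measure). 0 :: real)"
  proof (rule integral_dominated_convergence[where w = "\<lambda>x. (2 * (1 + real m)) * w x"])
    show "integrable lborel (\<lambda>x. (2 * (1 + real m)) * w x)" using w by (rule integrable_mult_right)
    have "(\<lambda>n. norm (cut m (u x) - cut m (g n x)) * w x) \<longlonglongrightarrow> 0" if "x \<notin> N" for x
    proof -
      have "(\<lambda>n. cut m (g n x)) \<longlonglongrightarrow> cut m (u x)"
        using lim[OF that] by (intro continuous_on_tendsto_compose[OF cut_cont]) auto
      then have "(\<lambda>n. norm (cut m (u x) - cut m (g n x)) * w x) \<longlonglongrightarrow> norm (cut m (u x) - cut m (u x)) * w x"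
        by (intro tendsto_intros)
      then show ?thesis by simp
    qed
    then show "AE x in lborel. (\<lambda>n. norm (cut m (u x) - cut m (g n x)) * w x) \<longlonglongrightarrow> 0"
      by (rule eventually_mono[OF ae])
    show "AE x in lborel. norm (norm (cut m (u x) - cut m (g n x)) * w x) \<le> (2 * (1 + real m)) * w x" for n
      by (intro AE_I2 dom2)
  qed measurable
  then have "\<forall>\<^sub>F n in sequentially. (LINT x|lborel. norm (cut m (u x) - cut m (g n x)) * w x) < e / 2"
    using e by (intro order_tendstoD(2)) auto
  then obtain n where n: "(LINT x|lborel. norm (cut m (u x) - cut m (g n x)) * w x) < e / 2"
    using eventually_happens'[OF sequentially_bot] by blast
  have int: "integrable lborel (\<lambda>x. norm (u x - cut m (u x)) * w x)"
    "integrable lborel (\<lambda>x. norm (cut m (u x) - cut m (g n x)) * w x)"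
  proof -
    show "integrable lborel (\<lambda>x. norm (u x - cut m (u x)) * w x)"
      by (rule Bochner_Integration.integrable_bound[OF integrable_mult_right[OF uw, of 2]])
        (measurable, intro AE_I2 order_trans[OF dom1], simp)
    show "integrable lborel (\<lambda>x. norm (cut m (u x) - cut m (g n x)) * w x)"
      by (rule Bochner_Integration.integrable_bound[OF integrable_mult_right[OF w, of "2 * (1 + real m)"]])
        (measurable, intro AE_I2 order_trans[OF dom2], simp)
  qed
  have "(LINT x|lborel. norm (u x - cut m (g n x)) * w x)
      \<le> (LINT x|lborel. norm (u x - cut m (u x)) * w x + norm (cut m (u x) - cut m (g n x)) * w x)"
  proof (rule integral_mono')
    show "norm (u x - cut m (g n x)) * w x
        \<le> norm (u x - cut m (u x)) * w x + norm (cut m (u x) - cut m (g n x)) * w x" for x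
      unfolding distrib_right[symmetric]
      using norm_triangle_ineq[of "u x - cut m (u x)" "cut m (u x) - cut m (g n x)"]
      by (intro mult_right_mono w0) simp
  qed (use int w0 in auto)
  also have "\<dots> < e" using m n int by simp
  finally show ?thesis using that[OF gc cut_le(2)] by blast
qed

lemma gaussian_commute: "gaussian t x y = gaussian t y x"
  by (simp add: gaussian_def norm_minus_commute)

lemma borel_measurable_gaussian_pair [measurable]:
  assumes [measurable]: "f \<in> borel_measurable M" "g \<in> borel_measurable M"
  shows "(\<lambda>p. gaussian t (f p) (g p)) \<in> borel_measurable M"
  unfolding gaussian_def by measurable

lemma borel_measurable_gaussian_average [measurable]:
  fixes f :: "'a::euclidean_space \<Rightarrow> complex"
  assumes [measurable]: "f \<in> borel_measurable borel"
  shows "gaussian_average t f \<in> borel_measurable borel"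
  unfolding gaussian_average_def[abs_def] by measurable

lemma gaussian_average_bounded:
  fixes f :: "'a::euclidean_space \<Rightarrow> complex"
  assumes bdd: "\<And>y. norm (f y) \<le> B" and t: "t > 0"
  shows "norm (gaussian_average t f x) \<le> B"
proof -
  have "B \<ge> 0" using bdd[of 0] norm_ge_zero order_trans by blast
  then have "norm (LINT y|lborel. f y * of_real (gaussian t x y)) \<le> (LINT y|lborel. B * gaussian t x y)"
    using t bdd
    by (intro order_trans[OF integral_norm_bound] integral_mono' integrable_mult_right integrable_gaussian)
      (auto simp: norm_mult gaussian_pos less_imp_le intro!: mult_right_mono)
  also have "\<dots> = B * sqrt (pi / t) ^ DIM('a)" using t by (simp add: integral_gaussian)
  finally have "norm (gaussian_average t f x) \<le> sqrt (t / pi) ^ DIM('a) * (B * sqrt (pi / t) ^ DIM('a))"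
    using t unfolding gaussian_average_def norm_mult norm_of_real
    by (intro mult_mono) auto
  also have "\<dots> = B * (sqrt (t / pi) * sqrt (pi / t)) ^ DIM('a)"
    by (simp add: power_mult_distrib)
  also have "sqrt (t / pi) * sqrt (pi / t) = 1"
    using t by (simp add: real_sqrt_mult[symmetric])
  finally show ?thesis by simp
qed

text \<open>
  By the parallelogram inequality \<open>\<bar>y\<bar>\<^sup>2 \<le> 2 \<bar>x\<bar>\<^sup>2 + 2 \<bar>y - x\<bar>\<^sup>2\<close> the weight at \<open>x\<close> can be traded for a
  flatter weight at \<open>y\<close>, at the expense of one unit of \<open>t\<close> in the kernel. Hence averaging is bounded
  between the two weighted spaces, uniformly in \<open>t \<ge> 2\<close>.
\<close>
lemma gaussian_kernel_weight:
  "gaussian t x y * gaussian 1 0 x \<le> gaussian (1 / 2) 0 y * gaussian (t - 1) x y"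
proof -
  have "norm y \<le> norm (y - x) + norm x"
    by (metis norm_triangle_ineq diff_add_cancel)
  then have "(norm y)\<^sup>2 \<le> (norm (y - x) + norm x)\<^sup>2" by (intro power_mono) auto
  also have "\<dots> \<le> 2 * (norm (y - x))\<^sup>2 + 2 * (norm x)\<^sup>2"
    using sum_squares_bound[of "norm (y - x)" "norm x"] by (simp add: power2_sum)
  finally show ?thesis
    by (simp add: gaussian_def algebra_simps flip: exp_add)
qed

lemma
  fixes h :: "'a::euclidean_space \<Rightarrow> complex"
  assumes h [measurable]: "h \<in> borel_measurable borel" and t: "t \<ge> 2"
    and int: "integrable lborel (\<lambda>y. norm (h y) * gaussian (1 / 2) 0 y)"
  shows integrable_gaussian_average_weighted:
      "integrable lborel (\<lambda>x. norm (gaussian_average t h x) * gaussian 1 0 x)"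
    and integral_gaussian_average_weighted:
      "(LINT x|lborel. norm (gaussian_average t h x) * gaussian 1 0 x)
        \<le> sqrt 2 ^ DIM('a) * (LINT y|lborel. norm (h y) * gaussian (1 / 2) 0 y)"
proof -
  let ?k = "\<lambda>y x. norm (h y) * gaussian (1 / 2) 0 y * gaussian (t - 1) x y"
  let ?c = "sqrt (t / pi) ^ DIM('a)"
  have t1: "t - 1 > 0" using t by simp
  have inner: "(LINT x|lborel. ?k y x) = norm (h y) * gaussian (1 / 2) 0 y * sqrt (pi / (t - 1)) ^ DIM('a)" for y
    using integral_gaussian[OF t1, of y] by (simp add: gaussian_commute[of _ _ y])
  have pair: "integrable (lborel \<Otimes>\<^sub>M lborel) (case_prod ?k)"
  proof (rule lborel_pair.Fubini_integrable)
    have "norm (case (y, x) of (y, x) \<Rightarrow> ?k y x) = ?k y x" for x y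
      by (simp add: abs_mult gaussian_pos less_imp_le)
    then show "integrable lborel (\<lambda>y. LINT x|lborel. norm (case (y, x) of (y, x) \<Rightarrow> ?k y x))"
      by (simp only: inner) (rule integrable_mult_left[OF int])
    have "integrable lborel (\<lambda>x. gaussian (t - 1) x y)" for y :: 'a
      using integrable_gaussian[OF t1, of y] by (simp add: gaussian_commute[of _ _ y])
    then show "AE y in lborel. integrable lborel (\<lambda>x. case (y, x) of (y, x) \<Rightarrow> ?k y x)"
      by (intro AE_I2) simp
  qed measurable
  have outer: "integrable lborel (\<lambda>x. ?c * (LINT y|lborel. ?k y x))"
    by (intro integrable_mult_right lborel_pair.integrable_snd pair)
  have le: "norm (gaussian_average t h x) * gaussian 1 0 x \<le> ?c * (LINT y|lborel. ?k y x)" for x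
  proof -
    have "norm (LINT y|lborel. h y * of_real (gaussian t x y)) * gaussian 1 0 x
        \<le> (LINT y|lborel. norm (h y * of_real (gaussian t x y))) * gaussian 1 0 x"
      by (intro mult_right_mono integral_norm_bound) (simp add: gaussian_pos less_imp_le)
    also have "\<dots> = (LINT y|lborel. norm (h y) * (gaussian t x y * gaussian 1 0 x))"
      by (simp add: norm_mult gaussian_pos less_imp_le mult.assoc flip: integral_mult_left_zero)
    also have "\<dots> \<le> (LINT y|lborel. ?k y x)"
    proof (rule integral_mono')
      show "integrable lborel (\<lambda>y. ?k y x)"
      proof (rule Bochner_Integration.integrable_bound[OF int])
        show "AE y in lborel. norm (?k y x) \<le> norm (norm (h y) * gaussian (1 / 2) 0 y)"
          using t1 by (intro AE_I2)
            (simp add: abs_mult gaussian_pos less_imp_le mult_left_le gaussian_le_1)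
      qed measurable
      show "norm (h y) * (gaussian t x y * gaussian 1 0 x) \<le> ?k y x" for y
        unfolding mult.assoc by (intro mult_left_mono gaussian_kernel_weight) auto
    qed (simp add: gaussian_pos less_imp_le)
    finally have "?c * (norm (LINT y|lborel. h y * of_real (gaussian t x y)) * gaussian 1 0 x)
        \<le> ?c * (LINT y|lborel. ?k y x)"
      using t by (intro mult_left_mono) auto
    then show ?thesis
      using t by (simp add: gaussian_average_def norm_mult mult.assoc norm_power)
  qed
  show "integrable lborel (\<lambda>x. norm (gaussian_average t h x) * gaussian 1 0 x)"
  proof (rule Bochner_Integration.integrable_bound[OF outer])
    have "norm (norm (gaussian_average t h x) * gaussian 1 0 x) = norm (gaussian_average t h x) * gaussian 1 0 x" for x
      by (simp add: gaussian_pos less_imp_le)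
    then show "AE x in lborel. norm (norm (gaussian_average t h x) * gaussian 1 0 x)
        \<le> norm (?c * (LINT y|lborel. ?k y x))"
      using order_trans[OF le abs_ge_self] by (intro AE_I2) (simp only: real_norm_def)
  qed measurable
  have "(LINT x|lborel. norm (gaussian_average t h x) * gaussian 1 0 x)
      \<le> (LINT x|lborel. ?c * (LINT y|lborel. ?k y x))"
  proof (rule integral_mono'[OF outer])
    have "0 \<le> norm (gaussian_average t h x) * gaussian 1 0 x" for x :: 'a
      by (simp add: gaussian_pos less_imp_le)
    then show "0 \<le> ?c * (LINT y|lborel. ?k y x)" for x using le order_trans by blast
  qed (rule le)
  also have "\<dots> = ?c * (LINT y|lborel. (LINT x|lborel. ?k y x))"
    unfolding lborel_pair.Fubini_integral[OF pair, symmetric] by (rule integral_mult_right_zero)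
  also have "\<dots> = ?c * (LINT y|lborel. norm (h y) * gaussian (1 / 2) 0 y * sqrt (pi / (t - 1)) ^ DIM('a))"
    unfolding inner ..
  also have "\<dots> = ?c * sqrt (pi / (t - 1)) ^ DIM('a) * (LINT y|lborel. norm (h y) * gaussian (1 / 2) 0 y)"
    unfolding integral_mult_left_zero by (simp only: mult_ac)
  also have "\<dots> \<le> sqrt 2 ^ DIM('a) * (LINT y|lborel. norm (h y) * gaussian (1 / 2) 0 y)"
  proof (rule mult_right_mono)
    have "t / pi * (pi / (t - 1)) \<le> 2" using t by (simp add: field_simps)
    then show "?c * sqrt (pi / (t - 1)) ^ DIM('a) \<le> sqrt 2 ^ DIM('a)"
      using t by (simp only: power_mult_distrib[symmetric] real_sqrt_mult[symmetric]) (intro power_mono, auto)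
    show "0 \<le> (LINT y|lborel. norm (h y) * gaussian (1 / 2) 0 y)"
      by (intro Bochner_Integration.integral_nonneg) (simp add: gaussian_pos less_imp_le)
  qed
  finally show "(LINT x|lborel. norm (gaussian_average t h x) * gaussian 1 0 x)
      \<le> sqrt 2 ^ DIM('a) * (LINT y|lborel. norm (h y) * gaussian (1 / 2) 0 y)" .
qed

lemma gaussian_average_diff:
  assumes "integrable lborel (\<lambda>y. u y * of_real (gaussian t x y))"
    and "integrable lborel (\<lambda>y. h y * of_real (gaussian t x y))"
  shows "gaussian_average t (\<lambda>y. u y - h y) x = gaussian_average t u x - gaussian_average t h x"
  using assms by (simp add: gaussian_average_def left_diff_distrib right_diff_distrib)

text \<open>
  For bounded continuous functions this is dominated convergence. These functions approximate \<open>u\<close> in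
  the flatter weight, and the averages of the error are controlled uniformly in \<open>t\<close>. The restriction
  to \<open>t \<ge> 2\<close> keeps the mass of the kernel bounded after the unit of \<open>t\<close> lost in \<open>gaussian_kernel_weight\<close>.
\<close>
lemma gaussian_average_tendsto_L1:
  fixes u :: "'a::euclidean_space \<Rightarrow> complex"
  assumes u [measurable]: "u \<in> borel_measurable borel"
    and int: "\<And>t x. t > 0 \<Longrightarrow> integrable lborel (\<lambda>y. u y * of_real (gaussian t x y))"
    and t: "\<And>k. t k \<ge> 2" "filterlim t at_top sequentially"
  shows "integrable lborel (\<lambda>x. norm (gaussian_average (t k) u x - u x) * gaussian 1 0 x)"
    and "(\<lambda>k. LINT x|lborel. norm (gaussian_average (t k) u x - u x) * gaussian 1 0 x) \<longlonglongrightarrow> 0"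
proof -
  define D where "D = sqrt 2 ^ DIM('a)"
  have D: "D \<ge> 0" by (simp add: D_def)
  have tpos: "t k > 0" for k using t(1)[of k] by simp
  have norm_int: "integrable lborel (\<lambda>y. norm (u y) * gaussian s 0 y)" if "s > 0" for s
    using integrable_norm[OF int[OF that, of 0]] by (simp add: norm_mult gaussian_pos less_imp_le)
  have g_mono: "gaussian 1 (0::'a) x \<le> gaussian (1 / 2) 0 x" for x
    by (simp add: gaussian_def)
  show "integrable lborel (\<lambda>x. norm (gaussian_average (t k) u x - u x) * gaussian 1 0 x)" for k
  proof (rule Bochner_Integration.integrable_bound)
    show "integrable lborel (\<lambda>x. norm (gaussian_average (t k) u x) * gaussian 1 0 x + norm (u x) * gaussian 1 0 x)"
      by (intro Bochner_Integration.integrable_add integrable_gaussian_average_weighted norm_int t u) auto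
    have le: "norm (gaussian_average (t k) u x - u x) * gaussian 1 0 x
        \<le> norm (gaussian_average (t k) u x) * gaussian 1 0 x + norm (u x) * gaussian 1 0 x" for x
      unfolding distrib_right[symmetric]
      by (intro mult_right_mono norm_triangle_ineq4) (simp add: gaussian_pos less_imp_le)
    have nn: "norm (norm (gaussian_average (t k) u x - u x) * gaussian 1 0 x)
        = norm (gaussian_average (t k) u x - u x) * gaussian 1 0 x" for x
      by (simp add: gaussian_pos less_imp_le)
    show "AE x in lborel. norm (norm (gaussian_average (t k) u x - u x) * gaussian 1 0 x)
        \<le> norm (norm (gaussian_average (t k) u x) * gaussian 1 0 x + norm (u x) * gaussian 1 0 x)"
      unfolding nn by (intro AE_I2 order_trans[OF le]) (unfold real_norm_def, rule abs_ge_self)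
  qed measurable
  show "(\<lambda>k. LINT x|lborel. norm (gaussian_average (t k) u x - u x) * gaussian 1 0 x) \<longlonglongrightarrow> 0"
  proof (rule LIMSEQ_I)
    fix e :: real assume e: "e > 0"
    \<comment> \<open>The error \<open>u - h\<close> enters once directly and once through its average, at the cost of a factor \<open>D\<close>.\<close>
    define \<delta> where "\<delta> = e / (2 * (D + 1))"
    have \<delta>: "\<delta> > 0" using e D by (simp add: \<delta>_def)
    obtain h B where h: "continuous_on UNIV h" and B: "\<And>x. norm (h x) \<le> B"
      and close: "(LINT x|lborel. norm (u x - h x) * gaussian (1 / 2) 0 x) < \<delta>"
    proof (rule bounded_continuous_approximation[OF u integrable_gaussian _ norm_int \<delta>])
      show "(1::real) / 2 > 0" "(1::real) / 2 > 0" by simp_all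
      show "0 \<le> gaussian (1 / 2) (0::'a) x" for x by (rule less_imp_le[OF gaussian_pos])
    qed blast
    have [measurable]: "h \<in> borel_measurable borel" using h by (rule borel_measurable_continuous_onI)
    have hint: "integrable lborel (\<lambda>y. h y * of_real (gaussian s x y))" if "s > 0" for s x
      using B that
      by (intro Bochner_Integration.integrable_bound[OF integrable_mult_right[OF integrable_gaussian[OF that, of x], of B]] AE_I2)
        (auto simp: norm_mult abs_mult gaussian_pos less_imp_le intro!: mult_right_mono order_trans[OF B abs_ge_self])
    have diff_int: "integrable lborel (\<lambda>x. norm (u x - h x) * gaussian (1 / 2) 0 x)"
    proof -
      have "integrable lborel (\<lambda>x. norm (u x * of_real (gaussian (1 / 2) 0 x) - h x * of_real (gaussian (1 / 2) 0 x)))"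
        by (intro integrable_norm Bochner_Integration.integrable_diff int hint) auto
      moreover have "norm (u x * of_real (gaussian (1 / 2) 0 x) - h x * of_real (gaussian (1 / 2) 0 x))
          = norm (u x - h x) * gaussian (1 / 2) 0 x" for x
        unfolding left_diff_distrib[symmetric] norm_mult norm_of_real abs_of_pos[OF gaussian_pos] ..
      ultimately show ?thesis by simp
    qed
    have avg_int: "integrable lborel (\<lambda>x. norm (gaussian_average (t k) (\<lambda>y. u y - h y) x) * gaussian 1 0 x)" for k
      by (intro integrable_gaussian_average_weighted t diff_int) measurable
    have avg_le: "(LINT x|lborel. norm (gaussian_average (t k) (\<lambda>y. u y - h y) x) * gaussian 1 0 x) \<le> D * \<delta>" for k
    proof -
      have "(LINT x|lborel. norm (gaussian_average (t k) (\<lambda>y. u y - h y) x) * gaussian 1 0 x)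
          \<le> D * (LINT x|lborel. norm (u x - h x) * gaussian (1 / 2) 0 x)"
        unfolding D_def by (intro integral_gaussian_average_weighted t diff_int) measurable
      also have "\<dots> \<le> D * \<delta>" using close D by (intro mult_left_mono) auto
      finally show ?thesis .
    qed
    have hdom: "norm (norm (gaussian_average (t k) h x - h x) * gaussian 1 0 x) \<le> 2 * B * gaussian 1 0 x" for k x
    proof -
      have "norm (gaussian_average (t k) h x - h x) \<le> 2 * B"
        using norm_triangle_ineq4[of "gaussian_average (t k) h x" "h x"] B[of x]
          gaussian_average_bounded[of h B "t k" x, OF B tpos] by linarith
      then show ?thesis
        unfolding real_norm_def abs_mult abs_norm_cancel abs_of_pos[OF gaussian_pos]
        by (intro mult_right_mono less_imp_le[OF gaussian_pos])
    qed
    have wB: "integrable lborel (\<lambda>x::'a. 2 * B * gaussian 1 0 x)"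
      by (intro integrable_mult_right integrable_gaussian) simp
    have h_int: "integrable lborel (\<lambda>x. norm (gaussian_average (t k) h x - h x) * gaussian 1 0 x)" for k
      by (rule Bochner_Integration.integrable_bound[OF wB])
        (measurable, intro AE_I2 order_trans[OF hdom], simp)
    have "(\<lambda>k. LINT x|lborel. norm (gaussian_average (t k) h x - h x) * gaussian 1 0 x)
        \<longlonglongrightarrow> (LINT x|(lborel :: 'a measure). 0 :: real)"
    proof (rule integral_dominated_convergence[OF _ _ wB])
      have "(\<lambda>k. norm (gaussian_average (t k) h x - h x) * gaussian 1 0 x) \<longlonglongrightarrow> norm (h x - h x) * gaussian 1 0 x" for x
        by (intro tendsto_intros gaussian_average_tendsto[OF h B tpos t(2)])
      then show "AE x in lborel. (\<lambda>k. norm (gaussian_average (t k) h x - h x) * gaussian 1 0 x) \<longlonglongrightarrow> 0"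
        by (intro AE_I2) simp
      show "AE x in lborel. norm (norm (gaussian_average (t k) h x - h x) * gaussian 1 0 x) \<le> 2 * B * gaussian 1 0 x" for k
        by (intro AE_I2 hdom)
    qed measurable
    then have "\<forall>\<^sub>F k in sequentially. (LINT x|lborel. norm (gaussian_average (t k) h x - h x) * gaussian 1 0 x) < e / 2"
      using e by (intro order_tendstoD(2)) auto
    then obtain k0 where k0: "\<And>k. k \<ge> k0 \<Longrightarrow>
        (LINT x|lborel. norm (gaussian_average (t k) h x - h x) * gaussian 1 0 x) < e / 2"
      unfolding eventually_sequentially by blast
    show "\<exists>k0. \<forall>k\<ge>k0. norm ((LINT x|lborel. norm (gaussian_average (t k) u x - u x) * gaussian 1 0 x) - 0) < e"
    proof (intro exI allI impI)
      fix k assume "k \<ge> k0"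
      let ?f = "\<lambda>x. norm (gaussian_average (t k) (\<lambda>y. u y - h y) x) * gaussian 1 0 x
          + norm (gaussian_average (t k) h x - h x) * gaussian 1 0 x + norm (u x - h x) * gaussian (1 / 2) 0 x"
      have "(LINT x|lborel. norm (gaussian_average (t k) u x - u x) * gaussian 1 0 x) \<le> (LINT x|lborel. ?f x)"
      proof (rule integral_mono')
        show "integrable lborel ?f"
          by (intro Bochner_Integration.integrable_add avg_int h_int diff_int)
        show "norm (gaussian_average (t k) u x - u x) * gaussian 1 0 x \<le> ?f x" for x
        proof -
          have "gaussian_average (t k) u x - u x
              = gaussian_average (t k) (\<lambda>y. u y - h y) x + (gaussian_average (t k) h x - h x) - (u x - h x)"
            by (simp add: gaussian_average_diff[OF int[OF tpos] hint[OF tpos]])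
          then have "norm (gaussian_average (t k) u x - u x)
              \<le> norm (gaussian_average (t k) (\<lambda>y. u y - h y) x) + norm (gaussian_average (t k) h x - h x) + norm (u x - h x)"
            by (metis add_right_mono norm_triangle_ineq norm_triangle_ineq4 order_trans)
          then have "norm (gaussian_average (t k) u x - u x) * gaussian 1 0 x
              \<le> (norm (gaussian_average (t k) (\<lambda>y. u y - h y) x) + norm (gaussian_average (t k) h x - h x) + norm (u x - h x))
                * gaussian 1 0 x"
            by (rule mult_right_mono) (rule less_imp_le[OF gaussian_pos])
          also have "\<dots> \<le> ?f x"
            unfolding distrib_right by (intro add_mono order_refl mult_left_mono g_mono) simp
          finally show ?thesis .
        qed
        show "0 \<le> ?f x" for x
          by (intro add_nonneg_nonneg mult_nonneg_nonneg less_imp_le[OF gaussian_pos] norm_ge_zero)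
      qed
      also have "\<dots> < D * \<delta> + e / 2 + \<delta>"
        using avg_le[of k] k0[OF \<open>k \<ge> k0\<close>] close
        by (simp add: Bochner_Integration.integral_add avg_int h_int diff_int)
      also have "D * \<delta> + e / 2 + \<delta> = e"
      proof -
        have "c * (e / (2 * c)) = e / 2" if "c \<noteq> 0" for c :: real
          using that by simp
        from this[of "D + 1"] have "(D + 1) * \<delta> = e / 2"
          using D unfolding \<delta>_def by linarith
        then show ?thesis by (simp add: distrib_right)
      qed
      finally have "(LINT x|lborel. norm (gaussian_average (t k) u x - u x) * gaussian 1 0 x) < e" .
      moreover have "0 \<le> (LINT x|lborel. norm (gaussian_average (t k) u x - u x) * gaussian 1 0 x)"
        by (intro Bochner_Integration.integral_nonneg mult_nonneg_nonneg less_imp_le[OF gaussian_pos] norm_ge_zero)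
      ultimately show "norm ((LINT x|lborel. norm (gaussian_average (t k) u x - u x) * gaussian 1 0 x) - 0) < e"
        by simp
    qed
  qed
qed

section \<open>Lipschitz continuity from Gaussian tests\<close>

lemma partial_gaussian:
  "partial v (\<lambda>y. complex_of_real (gaussian t x y)) y = of_real (- 2 * t * ((y - x) \<bullet> v) * gaussian t x y)"
  by (rule partial_eqI[OF has_derivative_of_real[OF gaussian_has_derivative]])

lemma partial_gaussian_decompose:
  fixes x y v :: "'a::euclidean_space"
  shows "partial v (\<lambda>y. complex_of_real (gaussian t x y)) y
    = (\<Sum>b\<in>Basis. of_real (v \<bullet> b) * partial b (\<lambda>y. complex_of_real (gaussian t x y)) y)"
proof -
  have "(y - x) \<bullet> v = (\<Sum>b\<in>Basis. (v \<bullet> b) * ((y - x) \<bullet> b))"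
    by (subst euclidean_inner) (simp add: mult.commute)
  then show ?thesis
    unfolding partial_gaussian by (simp add: sum_distrib_left sum_distrib_right mult_ac)
qed

text \<open>
  The majorant is uniform along the segment and is itself a Gaussian, so that it remains integrable
  against every function that is integrable against all Schwartz functions.
\<close>
lemma partial_gaussian_dominated:
  fixes x v :: "'a::euclidean_space"
  assumes t: "t > 0"
  shows "\<exists>C. \<forall>y s. 0 \<le> s \<longrightarrow> s \<le> 1 \<longrightarrow>
    norm (partial v (\<lambda>y. complex_of_real (gaussian t x y)) (y + s *\<^sub>R v)) \<le> C * gaussian (t / 4) x y"
proof -
  obtain B where B: "\<And>w::'a. (1 + norm w) ^ 1 * gaussian (t / 2) 0 w \<le> B"
    using power_times_gaussian_bounded[of "t / 2" 1 "0::'a"] t by auto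
  have "norm (partial v (\<lambda>y. complex_of_real (gaussian t x y)) (y + s *\<^sub>R v))
      \<le> (2 * t * norm v * B * exp (t / 2 * (norm v)\<^sup>2)) * gaussian (t / 4) x y"
    if s: "0 \<le> s" "s \<le> 1" for y s
  proof -
    define w where "w = y + s *\<^sub>R v - x"
    have wB: "norm w * gaussian (t / 2) 0 w \<le> B"
      using B[of w] gaussian_pos[of "t / 2" 0 w] by (simp add: distrib_right)
    have "y - x = w - s *\<^sub>R v" by (simp add: w_def)
    then have "norm (y - x) \<le> norm w + s * norm v"
      using norm_triangle_ineq4[of w "s *\<^sub>R v"] s by simp
    also have "\<dots> \<le> norm w + norm v"
      using s by (intro add_left_mono mult_left_le_one_le) auto
    finally have "(norm (y - x))\<^sup>2 \<le> (norm w + norm v)\<^sup>2"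
      by (intro power_mono) auto
    also have "\<dots> \<le> 2 * (norm w)\<^sup>2 + 2 * (norm v)\<^sup>2"
      using sum_squares_bound[of "norm w" "norm v"] by (simp add: power2_sum)
    finally have "t / 4 * (norm (y - x))\<^sup>2 \<le> t / 4 * (2 * (norm w)\<^sup>2 + 2 * (norm v)\<^sup>2)"
      using t by (intro mult_left_mono) auto
    then have g: "gaussian (t / 2) 0 w \<le> exp (t / 2 * (norm v)\<^sup>2) * gaussian (t / 4) x y"
      by (simp add: gaussian_def algebra_simps flip: exp_add)
    have "norm (partial v (\<lambda>y. complex_of_real (gaussian t x y)) (y + s *\<^sub>R v))
        = 2 * t * \<bar>w \<bullet> v\<bar> * gaussian t 0 w"
      using t unfolding partial_gaussian norm_of_real
      by (simp add: w_def gaussian_def abs_mult)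
    also have "\<dots> \<le> 2 * t * (norm w * norm v) * gaussian t 0 w"
      using t by (intro mult_right_mono mult_left_mono Cauchy_Schwarz_ineq2) (auto simp: gaussian_pos less_imp_le)
    also have "gaussian t 0 w = gaussian (t / 2) 0 w * gaussian (t / 2) 0 w"
      by (simp add: gaussian_def flip: exp_add)
    also have "2 * t * (norm w * norm v) * (gaussian (t / 2) 0 w * gaussian (t / 2) 0 w)
        = 2 * t * norm v * ((norm w * gaussian (t / 2) 0 w) * gaussian (t / 2) 0 w)"
      by (simp only: mult_ac)
    also have "\<dots> \<le> 2 * t * norm v * (B * (exp (t / 2 * (norm v)\<^sup>2) * gaussian (t / 4) x y))"
    proof (intro mult_left_mono mult_mono wB g)
      show "0 \<le> B" using wB by (rule order_trans[rotated]) (simp add: gaussian_pos less_imp_le)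
    qed (use t in \<open>auto simp: gaussian_pos less_imp_le\<close>)
    finally show ?thesis by (simp only: mult_ac)
  qed
  then show ?thesis by blast
qed

lemma norm_set_integral_unit_le:
  fixes h :: "real \<Rightarrow> complex"
  assumes "\<And>s. 0 \<le> s \<Longrightarrow> s \<le> 1 \<Longrightarrow> norm (h s) \<le> M"
  shows "norm (LINT s:{0..1}|lborel. h s) \<le> M"
proof -
  have M: "0 \<le> M" using order_trans[OF norm_ge_zero assms[of 0]] by simp
  have "norm (LINT s:{0..1}|lborel. h s) \<le> (LINT s|lborel. norm (indicator {0..1::real} s *\<^sub>R h s))"
    unfolding set_lebesgue_integral_def by (rule integral_norm_bound)
  also have "\<dots> \<le> (LINT s|lborel. indicator {0..1::real} s * M)"
  proof (rule integral_mono')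
    show "integrable lborel (\<lambda>s. indicator {0..1::real} s * M)" by simp
    show "norm (indicator {0..1::real} s *\<^sub>R h s) \<le> indicator {0..1::real} s * M" for s
      using assms[of s] by (simp add: indicator_def)
    show "0 \<le> indicator {0..1::real} s * M" for s
      using M by simp
  qed
  also have "\<dots> = M" by simp
  finally show ?thesis .
qed

text \<open>
  The hypothesis \<open>bound\<close> says that the distributional gradient of \<open>u\<close>, averaged against normalised
  Gaussians, is bounded uniformly in their centre and width.
\<close>
lemma gaussian_average_lipschitz:
  fixes u :: "'a::euclidean_space \<Rightarrow> complex"
  assumes u [measurable]: "u \<in> borel_measurable borel"
    and int: "\<And>\<phi>. schwartz \<phi> \<Longrightarrow> integrable lborel (\<lambda>y. u y * \<phi> y)"
    and bound: "\<And>b t x. b \<in> Basis \<Longrightarrow> t > 0 \<Longrightarrow>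
      norm (LINT y|lborel. u y * partial b (\<lambda>y. of_real (gaussian t x y)) y) \<le> K b * sqrt (pi / t) ^ DIM('a)"
    and t: "t > 0"
  shows "(\<Sum>b\<in>Basis. K b)-lipschitz_on UNIV (gaussian_average t u)"
proof (rule lipschitz_onI)
  define L where "L = (\<Sum>b\<in>Basis. K b)"
  define M where "M = sqrt (pi / t) ^ DIM('a)"
  let ?G = "\<lambda>x y. complex_of_real (gaussian t x y)"
  have M: "M > 0" using t by (simp add: M_def)
  have K: "K b \<ge> 0" if "b \<in> Basis" for b
  proof -
    have "0 \<le> K b * M" unfolding M_def using order_trans[OF norm_ge_zero bound[OF that t]] .
    then show ?thesis using M by (simp add: zero_le_mult_iff)
  qed
  then show "0 \<le> (\<Sum>b\<in>Basis. K b)" by (rule sum_nonneg)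
  fix x z :: 'a
  define v where "v = x - z"
  have S: "schwartz (?G c)" for c :: 'a using t by (rule schwartz_gaussian)
  have shift: "?G x (y + v) = ?G z y" for y
    by (simp add: gaussian_def v_def algebra_simps)
  have inner: "norm (LINT y|lborel. u y * partial v (?G x) (y + s *\<^sub>R v)) \<le> norm v * L * M" for s
  proof -
    define c where "c = x - s *\<^sub>R v"
    have "u y * partial v (?G x) (y + s *\<^sub>R v) = (\<Sum>b\<in>Basis. of_real (v \<bullet> b) * (u y * partial b (?G c) y))" for y
    proof -
      have "partial v (?G x) (y + s *\<^sub>R v) = partial v (?G c) y"
        unfolding partial_gaussian by (simp add: gaussian_def c_def algebra_simps)
      then show ?thesis
        unfolding partial_gaussian_decompose[of v t c y] by (simp only: sum_distrib_left mult.left_commute)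
    qed
    then have "(LINT y|lborel. u y * partial v (?G x) (y + s *\<^sub>R v))
        = (LINT y|lborel. (\<Sum>b\<in>Basis. of_real (v \<bullet> b) * (u y * partial b (?G c) y)))"
      by simp
    also have "\<dots> = (\<Sum>b\<in>Basis. of_real (v \<bullet> b) * (LINT y|lborel. u y * partial b (?G c) y))"
      by (subst Bochner_Integration.integral_sum) (auto intro!: integrable_mult_right int schwartz_partial S)
    also have "norm \<dots> \<le> (\<Sum>b\<in>Basis. norm v * (K b * M))"
    proof (rule sum_norm_le)
      fix b :: 'a assume b: "b \<in> Basis"
      show "norm (of_real (v \<bullet> b) * (LINT y|lborel. u y * partial b (?G c) y)) \<le> norm v * (K b * M)"
        unfolding norm_mult norm_of_real M_def
        by (intro mult_mono Basis_le_norm b bound t) auto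
    qed
    also have "\<dots> = norm v * L * M"
      by (simp add: L_def sum_distrib_left sum_distrib_right mult.assoc)
    finally show ?thesis .
  qed
  obtain C where C: "\<And>y s. 0 \<le> s \<Longrightarrow> s \<le> 1 \<Longrightarrow>
      norm (partial v (?G x) (y + s *\<^sub>R v)) \<le> C * gaussian (t / 4) x y"
    using partial_gaussian_dominated[OF t] by blast
  have "(LINT y|lborel. u y * (?G x (y + v) - ?G x y))
      = (LINT s:{0..1}|lborel. (LINT y|lborel. u y * partial v (?G x) (y + s *\<^sub>R v)))"
  proof (rule integral_increment[OF schwartz_differentiable[OF S] _ u C])
    show "continuous_on UNIV (partial v (?G x))"
      unfolding partial_gaussian[abs_def] by (intro continuous_intros)
    have "integrable lborel (\<lambda>y. u y * complex_of_real (gaussian (t / 4) x y))"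
      using t by (intro int schwartz_gaussian) auto
    from integrable_mult_right[OF integrable_norm[OF this], of C]
    show "integrable lborel (\<lambda>y. norm (u y) * (C * gaussian (t / 4) x y))"
      by (simp add: norm_mult gaussian_pos less_imp_le mult_ac)
  qed
  then have le: "norm (LINT y|lborel. u y * (?G z y - ?G x y)) \<le> norm v * L * M"
    unfolding shift using norm_set_integral_unit_le[OF inner] by simp
  have "gaussian_average t u z - gaussian_average t u x
      = of_real (sqrt (t / pi) ^ DIM('a)) * (LINT y|lborel. u y * (?G z y - ?G x y))"
    unfolding gaussian_average_def right_diff_distrib[symmetric]
    using int[OF S[of z]] int[OF S[of x]] by (simp add: right_diff_distrib)
  then have "norm (gaussian_average t u z - gaussian_average t u x)
      = sqrt (t / pi) ^ DIM('a) * norm (LINT y|lborel. u y * (?G z y - ?G x y))"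
    using t by (simp add: norm_mult norm_power)
  also have "\<dots> \<le> sqrt (t / pi) ^ DIM('a) * (norm v * L * M)"
    using t by (intro mult_left_mono le) auto
  also have "\<dots> = L * norm v * (sqrt (t / pi) * sqrt (pi / t)) ^ DIM('a)"
    by (simp add: M_def power_mult_distrib mult_ac)
  also have "sqrt (t / pi) * sqrt (pi / t) = 1"
    using t by (simp add: real_sqrt_mult[symmetric])
  finally show "dist (gaussian_average t u x) (gaussian_average t u z) \<le> (\<Sum>b\<in>Basis. K b) * dist x z"
    by (simp add: dist_norm v_def L_def norm_minus_commute)
qed

text \<open>
  Along a subsequence the averages converge to \<open>u\<close> almost everywhere. A common Lipschitz constant
  passes to the limit on the set of convergence, which is dense because its complement is null, and
  the Lipschitz function on this set extends to its closure.
\<close>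
lemma lipschitz_representative:
  fixes u :: "'a::euclidean_space \<Rightarrow> complex"
  assumes u [measurable]: "u \<in> borel_measurable borel"
    and int: "\<And>t x. t > 0 \<Longrightarrow> integrable lborel (\<lambda>y. u y * of_real (gaussian t x y))"
    and lip: "\<And>t. t > 0 \<Longrightarrow> L-lipschitz_on UNIV (gaussian_average t u)"
  shows "\<exists>g. L-lipschitz_on UNIV g \<and> (AE x in lborel. u x = g x)"
proof -
  define t :: "nat \<Rightarrow> real" where "t k = real k + 2" for k
  have t: "t k \<ge> 2" for k by (simp add: t_def)
  have t_lim: "filterlim t at_top sequentially"
    unfolding t_def[abs_def] by real_asymp
  let ?d = "\<lambda>k x. norm (gaussian_average (t k) u x - u x) * gaussian 1 0 x"
  note L1 = gaussian_average_tendsto_L1[where t = t, OF u int t t_lim]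
  have "(\<lambda>k. LINT x|lborel. norm (?d k x)) \<longlonglongrightarrow> 0"
    using L1(2) by (simp add: gaussian_pos less_imp_le)
  from tendsto_L1_AE_subseq[where u = ?d, OF L1(1) this]
  obtain r :: "nat \<Rightarrow> nat" where r: "AE x in lborel. (\<lambda>k. ?d (r k) x) \<longlonglongrightarrow> 0" by blast
  define E where "E = {x. (\<lambda>k. gaussian_average (t (r k)) u x) \<longlonglongrightarrow> u x}"
  have "(\<lambda>k. gaussian_average (t (r k)) u x) \<longlonglongrightarrow> u x" if "(\<lambda>k. ?d (r k) x) \<longlonglongrightarrow> 0" for x
  proof -
    have "(\<lambda>k. ?d (r k) x / gaussian 1 0 x) \<longlonglongrightarrow> 0 / gaussian 1 0 x"
      using that by (rule tendsto_divide) (auto simp: gaussian_def)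
    then have "(\<lambda>k. norm (gaussian_average (t (r k)) u x - u x)) \<longlonglongrightarrow> 0"
      using gaussian_pos[of 1 0 x] by simp
    then show ?thesis by (simp add: LIM_zero_iff tendsto_norm_zero_iff)
  qed
  then have E: "AE x in lborel. x \<in> E"
    unfolding E_def by (intro eventually_mono[OF r]) simp
  have "AE x in lebesgue. x \<in> closure E"
    using E closure_subset by (intro AE_completion) (auto elim: eventually_mono)
  then have dense: "closure E = UNIV"
    using mem_closed_if_AE_lebesgue[OF closed_closure] by blast
  have "L-lipschitz_on E u"
  proof (rule lipschitz_onI)
    show "0 \<le> L" using lip[of 1] by (rule lipschitz_on_nonneg) simp
    fix x y assume "x \<in> E" "y \<in> E"
    then have "(\<lambda>k. dist (gaussian_average (t (r k)) u x) (gaussian_average (t (r k)) u y)) \<longlonglongrightarrow> dist (u x) (u y)"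
      unfolding E_def by (intro tendsto_dist) auto
    moreover have "dist (gaussian_average (t (r k)) u x) (gaussian_average (t (r k)) u y) \<le> L * dist x y" for k
      using t[of "r k"] by (intro lipschitz_onD[OF lip]) auto
    ultimately show "dist (u x) (u y) \<le> L * dist x y"
      by (intro LIMSEQ_le_const2) auto
  qed
  from lipschitz_extend_closure[OF this]
  obtain g where g: "L-lipschitz_on UNIV g" "\<And>x. x \<in> E \<Longrightarrow> g x = u x"
    unfolding dense by blast
  have "AE x in lborel. u x = g x"
    by (rule eventually_mono[OF E]) (simp add: g(2))
  then show ?thesis using g(1) by blast
qed

text \<open>Measurability comes from the test against a Gaussian, by which one can divide.\<close>
lemma tempered_borel_representative:
  fixes a :: "real^'n::finite \<Rightarrow> complex"
  assumes "tempered_fun a"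
  obtains u where "u \<in> borel_measurable borel" "AE x in lborel. a x = u x"
proof -
  let ?g = "\<lambda>y::real^'n. complex_of_real (gaussian 1 0 y)"
  have "integrable lebesgue (\<lambda>x. a x * ?g x)"
    using assms by (simp add: tempered_fun_def schwartz_gaussian)
  then have "(\<lambda>x. a x * ?g x) \<in> borel_measurable lebesgue" by auto
  moreover have "?g \<in> borel_measurable lebesgue" by (intro measurable_completion) simp
  ultimately have "(\<lambda>x. (a x * ?g x) / ?g x) \<in> borel_measurable lebesgue"
    by (rule borel_measurable_divide)
  moreover have "(a x * ?g x) / ?g x = a x" for x
    using gaussian_pos[of 1 0 x] by simp
  ultimately have a: "a \<in> borel_measurable lebesgue" by simp
  obtain v where v: "v \<in> borel_measurable lborel" "AE x in lborel. Re (a x) = v x"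
    using completion_ex_borel_measurable_real[of "\<lambda>x. Re (a x)" lborel] a by auto
  obtain w where w: "w \<in> borel_measurable lborel" "AE x in lborel. Im (a x) = w x"
    using completion_ex_borel_measurable_real[of "\<lambda>x. Im (a x)" lborel] a by auto
  show ?thesis
  proof (rule that)
    have [measurable]: "v \<in> borel_measurable borel" "w \<in> borel_measurable borel"
      using v(1) w(1) by auto
    show "(\<lambda>x. of_real (v x) + \<i> * of_real (w x)) \<in> borel_measurable borel" by measurable
    show "AE x in lborel. a x = of_real (v x) + \<i> * of_real (w x)"
      using v(2) w(2) by eventually_elim (simp add: complex_eq_iff)
  qed
qed

text \<open>
  The product of three Gaussians of parameter \<open>t\<close> is the Gaussian of parameter \<open>3 t\<close>, so the test of
  the commutators at \<open>t / 3\<close> yields the hypothesis of the Lipschitz criterion at \<open>t\<close>.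
\<close>
lemma lipschitz_fun_if_bounded:
  fixes a :: "real^'n::finite \<Rightarrow> complex" and B :: "'n \<Rightarrow> _"
  assumes a: "tempered_fun a"
    and B: "\<And>j f g \<phi>. schwartz f \<Longrightarrow> schwartz g \<Longrightarrow> schwartz \<phi> \<Longrightarrow>
      B j f g \<phi> = - (LINT x|lebesgue. a x * Dj j (\<lambda>x. f x * (g x * \<phi> x)) x)"
    and bdd: "\<And>j. \<exists>p q r. hoelder_triple p q r \<and> bounded_Lp p q r (B j)"
  shows "lipschitz_fun a"
proof -
  obtain u where u [measurable]: "u \<in> borel_measurable borel" and au: "AE x in lborel. a x = u x"
    using tempered_borel_representative[OF a] .
  have au': "AE x in lebesgue. a x = u x" using au by (rule AE_completion)
  have int_eq: "integrable lborel (\<lambda>y. u y * \<phi> y)" "(LINT y|lebesgue. a y * \<phi> y) = (LINT y|lborel. u y * \<phi> y)"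
    if \<phi>: "schwartz \<phi>" for \<phi>
  proof -
    have [measurable]: "\<phi> \<in> borel_measurable borel" using \<phi> by (rule schwartz_borel_measurable)
    have u\<phi>: "(\<lambda>y. u y * \<phi> y) \<in> borel_measurable borel" by measurable
    have u\<phi>': "(\<lambda>y. u y * \<phi> y) \<in> borel_measurable lebesgue" by (intro measurable_completion) simp
    have int: "integrable lebesgue (\<lambda>y. a y * \<phi> y)" using a \<phi> unfolding tempered_fun_def by blast
    have ae: "AE y in lebesgue. a y * \<phi> y = u y * \<phi> y" using au' by eventually_elim simp
    have "integrable lebesgue (\<lambda>y. u y * \<phi> y)"
      by (rule integrable_cong_AE_imp[OF int u\<phi>']) (use ae in eventually_elim, simp)
    then show "integrable lborel (\<lambda>y. u y * \<phi> y)"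
      using u\<phi> by (subst (asm) integrable_completion) auto
    have "(LINT y|lebesgue. a y * \<phi> y) = (LINT y|lebesgue. u y * \<phi> y)"
      using int u\<phi>' ae by (intro integral_cong_AE) auto
    then show "(LINT y|lebesgue. a y * \<phi> y) = (LINT y|lborel. u y * \<phi> y)"
      using u\<phi> by (simp only: lebesgue_integral_eq_lborel)
  qed
  let ?G = "\<lambda>t x y. complex_of_real (gaussian t x (y::real^'n))"
  have S: "schwartz (?G t x)" if "t > 0" for t x using that by (rule schwartz_gaussian)
  have "\<exists>K. \<forall>t>0. \<forall>x. norm (LINT y|lborel. u y * partial b (?G t x) y) \<le> K * sqrt (pi / t) ^ CARD('n)"
    if basis: "b \<in> Basis" for b
  proof -
    obtain j where b: "b = axis j 1" using basis by (auto simp: Basis_vec_def)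
    obtain p q r where "hoelder_triple p q r" "bounded_Lp p q r (B j)" using bdd by blast
    from bounded_Lp_gaussian[OF this(2,1)] obtain K
      where K: "\<And>t x. t > 0 \<Longrightarrow> norm (B j (?G t x) (?G t x) (?G t x)) \<le> K * sqrt (pi / t) ^ CARD('n)"
      by blast
    have "norm (LINT y|lborel. u y * partial b (?G t x) y) \<le> (K * sqrt 3 ^ CARD('n)) * sqrt (pi / t) ^ CARD('n)"
      if t: "t > 0" for t x
    proof -
      have t3: "t / 3 > 0" using t by simp
      have three: "(\<lambda>y. ?G (t / 3) x y * (?G (t / 3) x y * ?G (t / 3) x y)) = ?G t x"
        by (simp add: gaussian_def fun_eq_iff flip: of_real_mult exp_add)
      have "B j (?G (t / 3) x) (?G (t / 3) x) (?G (t / 3) x) = - (LINT y|lborel. u y * Dj j (?G t x) y)"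
        unfolding B[OF S[OF t3] S[OF t3] S[OF t3]] three int_eq(2)[OF Dj_schwartz[OF S[OF t]]] ..
      also have "\<dots> = \<i> * (LINT y|lborel. u y * partial b (?G t x) y)"
        unfolding Dj_def b[symmetric] mult.left_commute[of _ "- \<i>"] integral_mult_right_zero by simp
      finally have "norm (LINT y|lborel. u y * partial b (?G t x) y)
          = norm (B j (?G (t / 3) x) (?G (t / 3) x) (?G (t / 3) x))"
        by (simp add: norm_mult)
      also have "\<dots> \<le> K * sqrt (pi / (t / 3)) ^ CARD('n)" by (rule K[OF t3])
      also have "sqrt (pi / (t / 3)) = sqrt 3 * sqrt (pi / t)"
        by (simp add: mult.commute flip: real_sqrt_mult)
      finally show ?thesis by (simp only: power_mult_distrib mult.assoc)
    qed
    then show ?thesis by blast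
  qed
  then obtain K where K: "\<And>b t x. b \<in> Basis \<Longrightarrow> t > 0 \<Longrightarrow>
      norm (LINT y|lborel. u y * partial b (?G t x) y) \<le> K b * sqrt (pi / t) ^ DIM(real^'n)"
    by (simp only: DIM_cart DIM_real mult_1_right) metis
  have "(\<Sum>b\<in>Basis. K b)-lipschitz_on UNIV (gaussian_average t u)" if "t > 0" for t
    by (rule gaussian_average_lipschitz[OF u int_eq(1) K that])
  from lipschitz_representative[OF u int_eq(1)[OF S] this]
  obtain g where g: "(\<Sum>b\<in>Basis. K b)-lipschitz_on UNIV g" "AE x in lborel. u x = g x" by blast
  have "AE x in lborel. a x = g x" using au g(2) by eventually_elim simp
  then show ?thesis
    unfolding lipschitz_fun_def using g(1) AE_completion by blast
qed

text \<open>
  The claims on the whole class follow from those on the model operators, which belong to it. The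
  second commutator of \<open>T2 j\<close> is the first commutator of \<open>T1 j\<close> with \<open>f\<close> and \<open>g\<close> exchanged.
\<close>
theorem mainTheorem4:
  fixes a :: "real^'n::finite \<Rightarrow> complex"
  assumes "tempered_fun a"
  shows
    "(\<forall>j::'n. T1 j \<in> OpBS1) \<and>
     ((\<forall>j::'n. bounded_Lp 4 4 2 (commutator1 (T1 j) a)) \<longrightarrow> lipschitz_fun a) \<and>
     ((\<forall>T\<in>OpBS1. bounded_Lp 4 4 2 (commutator1 T a)) \<longrightarrow> lipschitz_fun a) \<and>
     ((\<forall>j::'n. \<exists>p q r. hoelder_triple p q r \<and> bounded_Lp p q r (commutator1 (T1 j) a))
        \<longrightarrow> lipschitz_fun a) \<and>
     ((\<forall>T\<in>OpBS1. \<exists>p q r. hoelder_triple p q r \<and> bounded_Lp p q r (commutator1 T a))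
        \<longrightarrow> lipschitz_fun a) \<and>
     (\<forall>j::'n. T2 j \<in> OpBS1) \<and>
     ((\<forall>j::'n. bounded_Lp 4 4 2 (commutator2 (T2 j) a)) \<longrightarrow> lipschitz_fun a) \<and>
     ((\<forall>T\<in>OpBS1. bounded_Lp 4 4 2 (commutator2 T a)) \<longrightarrow> lipschitz_fun a) \<and>
     ((\<forall>j::'n. \<exists>p q r. hoelder_triple p q r \<and> bounded_Lp p q r (commutator2 (T2 j) a))
        \<longrightarrow> lipschitz_fun a) \<and>
     ((\<forall>T\<in>OpBS1. \<exists>p q r. hoelder_triple p q r \<and> bounded_Lp p q r (commutator2 T a))
        \<longrightarrow> lipschitz_fun a)"
proof -
  have triple: "hoelder_triple 4 4 2" by (simp add: hoelder_triple_def)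
  have first: "lipschitz_fun a"
    if "\<And>j::'n. \<exists>p q r. hoelder_triple p q r \<and> bounded_Lp p q r (commutator1 (T1 j) a)"
    using assms commutator1_T1[OF assms] that by (rule lipschitz_fun_if_bounded)
  have second: "lipschitz_fun a"
    if "\<And>j::'n. \<exists>p q r. hoelder_triple p q r \<and> bounded_Lp p q r (commutator2 (T2 j) a)"
  proof (rule lipschitz_fun_if_bounded[OF assms _ that])
    fix j :: 'n and f g \<phi> :: "real^'n \<Rightarrow> complex"
    assume S: "schwartz f" "schwartz g" "schwartz \<phi>"
    show "commutator2 (T2 j) a f g \<phi> = - (LINT x|lebesgue. a x * Dj j (\<lambda>x. f x * (g x * \<phi> x)) x)"
      unfolding commutator2_T2 commutator1_T1[OF assms S(2,1,3)] by (simp only: mult.left_commute)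
  qed
  show ?thesis
    using triple first second T1_in_OpBS1 T2_in_OpBS1 by (intro conjI impI allI) blast+
qed

end
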